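(* For a Banach lattice $E$ the following statements are equivalent: (1) The identity operator $\mathrm{Id}_E : E \to E$ is order L-weakly compact. (2) The norm of $E$ is order continuous. (3) For every disjoint sequence $(f_n)$ of $B_{E'}$ we have $|f_n| \to 0$ for the topology $\sigma(E',E)$. (4) $f_n(x_n) \to 0$ for every order bounded sequence $(x_n)$ of $E$ and every disjoint sequence $(f_n)$ of $B_{E'}$.
   Context: All Banach lattices are real; "operator" means bounded linear map; $G'$ denotes the topological dual (a Banach lattice when $G$ is one), and $B_G$ the closed unit ball of $G$. A nonempty bounded subset $A$ of a Banach lattice $G$ is L-weakly compact if $\lim\|x_n\|=0$ for every disjoint sequence $(x_n)$ in the solid hull of $A$. An operator $T : G \to H$ between Banach lattices is order L-weakly compact if $T[0,x]$ is an L-weakly compact subset of $H$ for each $x\in G^+$. $\sigma(E',E)$ is the weak-star topology on $E'$. *)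

theory Defs
  imports "HOL-Analysis.Analysis" "HOL-Library.Lattice_Algebras"
begin

section \<open>Banach lattices\<close>

text \<open>The modulus is \<open>\<bar>x\<bar> = sup x (- x)\<close>, which is the axiom of
  \<^class>\<open>lattice_ab_group_add_abs\<close>.\<close>

class banach_lattice = banach + ordered_real_vector + lattice_ab_group_add_abs +
  assumes norm_mono_abs: "\<bar>x\<bar> \<le> \<bar>y\<bar> \<Longrightarrow> norm x \<le> norm y"

instance real :: banach_lattice
  by standard simp

definition disjoint_seq :: "(nat \<Rightarrow> 'a::banach_lattice) \<Rightarrow> bool" where
  "disjoint_seq x \<longleftrightarrow> (\<forall>m n. m \<noteq> n \<longrightarrow> inf \<bar>x m\<bar> \<bar>x n\<bar> = 0)"

definition solid_hull :: "'a::banach_lattice set \<Rightarrow> 'a set" where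
  "solid_hull A = {y. \<exists>x\<in>A. \<bar>y\<bar> \<le> \<bar>x\<bar>}"

definition L_weakly_compact :: "'a::banach_lattice set \<Rightarrow> bool" where
  "L_weakly_compact A \<longleftrightarrow> A \<noteq> {} \<and> bounded A \<and>
     (\<forall>x. disjoint_seq x \<and> range x \<subseteq> solid_hull A \<longrightarrow> (\<lambda>n. norm (x n)) \<longlonglongrightarrow> 0)"

definition order_L_weakly_compact ::
    "('a::banach_lattice \<Rightarrow>\<^sub>L 'b::banach_lattice) \<Rightarrow> bool" where
  "order_L_weakly_compact T \<longleftrightarrow> (\<forall>x\<ge>0. L_weakly_compact (blinfun_apply T ` {0..x}))"

definition order_bounded_seq :: "(nat \<Rightarrow> 'a::banach_lattice) \<Rightarrow> bool" where
  "order_bounded_seq x \<longleftrightarrow> (\<exists>u v. range x \<subseteq> {u..v})"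

text \<open>Order continuity of the norm: \<open>x\<^sub>\<alpha> \<down> 0\<close> implies \<open>\<parallel>x\<^sub>\<alpha>\<parallel> \<rightarrow> 0\<close> for nets. HOL cannot quantify
  over all index types, so a decreasing net is given by its range, a downward directed set \<open>D\<close>
  indexed by itself. Nets over arbitrary index sets are covered by
  \<open>order_continuous_norm_net\<close> below.\<close>

definition decreases_to_0 :: "'a::banach_lattice set \<Rightarrow> bool" where
  "decreases_to_0 D \<longleftrightarrow> D \<noteq> {} \<and> (\<forall>x\<in>D. \<forall>y\<in>D. \<exists>z\<in>D. z \<le> x \<and> z \<le> y) \<and>
     (\<forall>d\<in>D. 0 \<le> d) \<and> (\<forall>l. (\<forall>d\<in>D. l \<le> d) \<longrightarrow> l \<le> 0)"

definition order_continuous_norm :: "'a::banach_lattice itself \<Rightarrow> bool" where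
  "order_continuous_norm _ \<longleftrightarrow> (\<forall>D::'a set. decreases_to_0 D \<longrightarrow>
     (\<forall>e>0. \<exists>d\<in>D. \<forall>x\<in>D. x \<le> d \<longrightarrow> norm x < e))"

lemma order_continuous_norm_net:
  fixes x :: "'i \<Rightarrow> 'a::banach_lattice" and r :: "'i \<Rightarrow> 'i \<Rightarrow> bool"
  assumes "order_continuous_norm TYPE('a)"
    and "I \<noteq> {}" and dir: "\<And>i j. i \<in> I \<Longrightarrow> j \<in> I \<Longrightarrow> \<exists>k\<in>I. r i k \<and> r j k"
    and dec: "\<And>i j. i \<in> I \<Longrightarrow> j \<in> I \<Longrightarrow> r i j \<Longrightarrow> x j \<le> x i"
    and low: "\<And>i. i \<in> I \<Longrightarrow> 0 \<le> x i"
    and glb: "\<And>l. (\<And>i. i \<in> I \<Longrightarrow> l \<le> x i) \<Longrightarrow> l \<le> 0"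
    and "e > 0"
  shows "\<exists>i\<in>I. \<forall>j\<in>I. r i j \<longrightarrow> norm (x j) < e"
proof -
  have "decreases_to_0 (x ` I)"
    unfolding decreases_to_0_def
  proof (intro conjI ballI allI impI)
    fix y z assume "y \<in> x ` I" "z \<in> x ` I"
    then obtain i j where ij: "i \<in> I" "j \<in> I" "y = x i" "z = x j" by blast
    then obtain k where "k \<in> I" "r i k" "r j k" using dir by blast
    with ij dec show "\<exists>w\<in>x ` I. w \<le> y \<and> w \<le> z" by blast
  qed (use assms(2) low glb in auto)
  with assms(1) \<open>e > 0\<close> obtain d where "d \<in> x ` I"
      and d: "\<And>y. y \<in> x ` I \<Longrightarrow> y \<le> d \<Longrightarrow> norm y < e"
    unfolding order_continuous_norm_def by blast
  then obtain i where "i \<in> I" "d = x i" by blast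
  with d dec show ?thesis by blast
qed


section \<open>The dual Banach lattice\<close>

text \<open>A copy of the bounded linear functionals, so that it can carry the dual order and lattice
  structure as type class instances.\<close>

typedef (overloaded) 'a dual = "UNIV :: ('a::banach_lattice \<Rightarrow>\<^sub>L real) set"
  morphisms functional Dual ..

setup_lifting type_definition_dual

lift_definition dual_apply :: "'a::banach_lattice dual \<Rightarrow> 'a \<Rightarrow> real" is blinfun_apply .

instantiation dual :: (banach_lattice) real_normed_vector
begin

lift_definition norm_dual :: "'a dual \<Rightarrow> real" is norm .
lift_definition zero_dual :: "'a dual" is 0 .
lift_definition plus_dual :: "'a dual \<Rightarrow> 'a dual \<Rightarrow> 'a dual" is "(+)" .
lift_definition minus_dual :: "'a dual \<Rightarrow> 'a dual \<Rightarrow> 'a dual" is "(-)" .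
lift_definition uminus_dual :: "'a dual \<Rightarrow> 'a dual" is uminus .
lift_definition scaleR_dual :: "real \<Rightarrow> 'a dual \<Rightarrow> 'a dual" is "(*\<^sub>R)" .
definition sgn_dual :: "'a dual \<Rightarrow> 'a dual" where "sgn_dual f = inverse (norm f) *\<^sub>R f"
definition dist_dual :: "'a dual \<Rightarrow> 'a dual \<Rightarrow> real" where "dist_dual f g = norm (f - g)"
definition uniformity_dual :: "('a dual \<times> 'a dual) filter" where
  "uniformity_dual = (INF e\<in>{0<..}. principal {(f, g). dist f g < e})"
definition open_dual :: "'a dual set \<Rightarrow> bool" where
  "open_dual U \<longleftrightarrow> (\<forall>f\<in>U. \<forall>\<^sub>F (f', g) in uniformity. f' = f \<longrightarrow> g \<in> U)"

instance
proof
  fix f g h :: "'a dual" and a b :: real and U :: "'a dual set"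
  show "f + g + h = f + (g + h)" "f + g = g + f" "0 + f = f" "- f + f = 0" "f - g = f + - g"
    by (transfer, simp)+
  show "a *\<^sub>R (f + g) = a *\<^sub>R f + a *\<^sub>R g" "(a + b) *\<^sub>R f = a *\<^sub>R f + b *\<^sub>R f"
    by (transfer, simp add: algebra_simps)+
  show "a *\<^sub>R b *\<^sub>R f = (a * b) *\<^sub>R f" "1 *\<^sub>R f = f"
    by (transfer, simp)+
  show "dist f g = norm (f - g)" by (rule dist_dual_def)
  show "sgn f = inverse (norm f) *\<^sub>R f" by (rule sgn_dual_def)
  show "uniformity = (INF e\<in>{0<..}. principal {(f, g :: 'a dual). dist f g < e})"
    by (rule uniformity_dual_def)
  show "open U \<longleftrightarrow> (\<forall>f\<in>U. \<forall>\<^sub>F (f', g) in uniformity. f' = f \<longrightarrow> g \<in> U)"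
    by (rule open_dual_def)
  show "norm f = 0 \<longleftrightarrow> f = 0" by (transfer, simp)
  show "norm (f + g) \<le> norm f + norm g" by (transfer, rule norm_triangle_ineq)
  show "norm (a *\<^sub>R f) = \<bar>a\<bar> * norm f" by (transfer, simp)
qed

end

lemma dual_apply_simps [simp]:
  "dual_apply 0 x = 0"
  "dual_apply (f + g) x = dual_apply f x + dual_apply g x"
  "dual_apply (f - g) x = dual_apply f x - dual_apply g x"
  "dual_apply (- f) x = - dual_apply f x"
  "dual_apply (c *\<^sub>R f) x = c * dual_apply f x"
  by (transfer, simp add: blinfun.bilinear_simps)+

lemma bounded_linear_dual_apply: "bounded_linear (dual_apply f)"
  by transfer (rule blinfun.bounded_linear_right)

lemma dual_apply_zero_right [simp]: "dual_apply f 0 = 0"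
  by (rule linear_0[OF bounded_linear.linear[OF bounded_linear_dual_apply]])

lemma norm_dual_apply: "\<bar>dual_apply f x\<bar> \<le> norm f * norm x"
  by transfer (metis norm_blinfun real_norm_def)

lemma norm_dual_bound: "0 \<le> b \<Longrightarrow> (\<And>x. \<bar>dual_apply f x\<bar> \<le> b * norm x) \<Longrightarrow> norm f \<le> b"
  by transfer (metis norm_blinfun_bound real_norm_def)

lemma dual_eqI: "(\<And>x. dual_apply f x = dual_apply g x) \<Longrightarrow> f = g"
  by transfer (rule blinfun_eqI)

lemma ex_dual: "bounded_linear h \<Longrightarrow> \<exists>f. dual_apply f = h"
  by (rule exI[of _ "Dual (Blinfun h)"]) (simp add: bounded_linear_Blinfun_apply dual_apply.abs_eq)

instance dual :: (banach_lattice) banach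
proof
  fix X :: "nat \<Rightarrow> 'a dual"
  assume "Cauchy X"
  have d: "dist (functional f) (functional g) = dist f g" for f g :: "'a dual"
    by (simp add: dist_norm minus_dual.rep_eq norm_dual.rep_eq)
  then have "Cauchy (\<lambda>n. functional (X n))"
    using \<open>Cauchy X\<close> unfolding Cauchy_def by simp
  then obtain F where "(\<lambda>n. functional (X n)) \<longlonglongrightarrow> F"
    using Cauchy_convergent_iff convergent_def by blast
  then have "X \<longlonglongrightarrow> Dual F"
    unfolding lim_sequentially by (simp add: d[symmetric] Dual_inverse)
  then show "convergent X"
    by (auto simp: convergent_def)
qed

lemma riesz_decomposition:
  fixes a b y :: "'a::banach_lattice"
  assumes "0 \<le> a" "0 \<le> b" "0 \<le> y" "y \<le> a + b"
  obtains u v where "y = u + v" "0 \<le> u" "u \<le> a" "0 \<le> v" "v \<le> b"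
proof
  show "y = inf y a + (y - inf y a)"
    by (simp only: add.commute[of "inf y a"] diff_add_cancel)
  show "0 \<le> inf y a" using assms by simp
  show "inf y a \<le> a" by simp
  show "0 \<le> y - inf y a" by (simp only: diff_ge_0_iff_ge inf_le1)
  have "y - b \<le> inf y a"
    using assms by (simp add: diff_le_eq)
  then show "y - inf y a \<le> b" by (metis diff_le_eq add.commute)
qed

lemma norm_mono_pos: "0 \<le> x \<Longrightarrow> x \<le> y \<Longrightarrow> norm x \<le> norm (y::'a::banach_lattice)"
  by (rule norm_mono_abs) (metis abs_of_nonneg order_trans)

lemma ex_pos_part:
  fixes f :: "'a::banach_lattice dual"
  shows "\<exists>g. \<forall>x\<ge>0. (\<forall>y. 0 \<le> y \<and> y \<le> x \<longrightarrow> dual_apply f y \<le> dual_apply g x) \<and>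
           (\<forall>c. (\<forall>y. 0 \<le> y \<and> y \<le> x \<longrightarrow> dual_apply f y \<le> c) \<longrightarrow> dual_apply g x \<le> c)"
proof -
  interpret f: bounded_linear "dual_apply f" by (rule bounded_linear_dual_apply)
  define p where "p x = Sup (dual_apply f ` {0..x})" for x
  have fb: "dual_apply f y \<le> norm f * norm x" if "0 \<le> y" "y \<le> x" for x y
  proof -
    have "dual_apply f y \<le> norm f * norm y" using norm_dual_apply[of f y] by simp
    also have "\<dots> \<le> norm f * norm x" using that by (intro mult_left_mono norm_mono_pos) auto
    finally show ?thesis .
  qed
  have ub: "dual_apply f y \<le> p x" if "0 \<le> y" "y \<le> x" for x y
    unfolding p_def using that fb by (intro cSup_upper) (auto intro!: bdd_aboveI)
  have lub: "p x \<le> c" if "0 \<le> x" "\<And>y. 0 \<le> y \<Longrightarrow> y \<le> x \<Longrightarrow> dual_apply f y \<le> c" for x c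
    unfolding p_def using that by (intro cSup_least) auto
  have p_add: "p (a + b) = p a + p b" if ab: "0 \<le> a" "0 \<le> b" for a b
  proof (rule antisym)
    show "p (a + b) \<le> p a + p b"
    proof (rule lub)
      fix y assume y: "0 \<le> y" "y \<le> a + b"
      obtain u v where uv: "y = u + v" "0 \<le> u" "u \<le> a" "0 \<le> v" "v \<le> b"
        using riesz_decomposition[OF ab y] by blast
      show "dual_apply f y \<le> p a + p b"
        using uv ub[of u a] ub[of v b] by (simp add: f.add)
    qed (use ab in simp)
    have "p a \<le> p (a + b) - dual_apply f v" if v: "0 \<le> v" "v \<le> b" for v
    proof (rule lub)
      fix u assume u: "0 \<le> u" "u \<le> a"
      have "dual_apply f (u + v) \<le> p (a + b)"
        using u v by (intro ub add_nonneg_nonneg add_mono)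
      then show "dual_apply f u \<le> p (a + b) - dual_apply f v" by (simp add: f.add)
    qed (use ab in simp)
    then have "p b \<le> p (a + b) - p a"
      using ab by (intro lub) (auto simp: algebra_simps)
    then show "p a + p b \<le> p (a + b)" by simp
  qed
  have p_scale_le: "p (c *\<^sub>R a) \<le> c * p a" if "0 < c" "0 \<le> a" for c a
  proof (rule lub)
    fix y assume y: "0 \<le> y" "y \<le> c *\<^sub>R a"
    have "inverse c *\<^sub>R y \<le> inverse c *\<^sub>R (c *\<^sub>R a)"
      using y that by (intro scaleR_left_mono) auto
    then have "dual_apply f (inverse c *\<^sub>R y) \<le> p a"
      using y that by (intro ub) (auto intro: scaleR_nonneg_nonneg)
    then show "dual_apply f y \<le> c * p a"
      using that by (simp add: f.scaleR field_simps)
  qed (use that in \<open>simp add: scaleR_nonneg_nonneg\<close>)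
  have p_scale: "p (c *\<^sub>R a) = c * p a" if "0 < c" "0 \<le> a" for c a
  proof (rule antisym)
    show "p (c *\<^sub>R a) \<le> c * p a" by (rule p_scale_le[OF that])
    have "p (inverse c *\<^sub>R (c *\<^sub>R a)) \<le> inverse c * p (c *\<^sub>R a)"
      using that by (intro p_scale_le) (auto intro: scaleR_nonneg_nonneg)
    then show "c * p a \<le> p (c *\<^sub>R a)"
      using that by (simp add: field_simps)
  qed
  have p0: "p 0 = 0"
    using p_add[of 0 0] by simp
  define q where "q x = p (pprt x) - p (- nprt x)" for x
  have q_eq: "q (a - b) = p a - p b" if ab: "0 \<le> a" "0 \<le> b" for a b
  proof -
    have "a - b = pprt (a - b) + nprt (a - b)" by (rule prts)
    then have "pprt (a - b) + b = a + - nprt (a - b)" by (simp add: algebra_simps)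
    then have "p (pprt (a - b)) + p b = p a + p (- nprt (a - b))"
      using ab p_add[of "pprt (a - b)" b] p_add[of a "- nprt (a - b)"] by simp
    then show ?thesis by (simp add: q_def)
  qed
  have q_pos: "q x = p x" if "0 \<le> x" for x
    using that by (simp add: q_def p0)
  have dec: "x = pprt x - (- nprt x)" "0 \<le> - nprt x" for x :: 'a
    using prts[of x] by simp_all
  have "bounded_linear q"
  proof (rule bounded_linear_intro)
    fix x y :: 'a
    have "x + y = (pprt x + nprt x) + (pprt y + nprt y)"
      by (simp only: prts[symmetric])
    also have "\<dots> = (pprt x + pprt y) - (- nprt x + - nprt y)"
      by (simp add: algebra_simps)
    finally have "q (x + y) = q ((pprt x + pprt y) - (- nprt x + - nprt y))"
      by (rule arg_cong)
    also have "\<dots> = p (pprt x + pprt y) - p (- nprt x + - nprt y)"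
      by (intro q_eq add_nonneg_nonneg dec(2) zero_le_pprt)
    also have "\<dots> = (p (pprt x) + p (pprt y)) - (p (- nprt x) + p (- nprt y))"
      by (simp only: p_add dec(2) zero_le_pprt)
    also have "\<dots> = q x + q y" by (simp add: q_def)
    finally show "q (x + y) = q x + q y" .
  next
    fix c :: real and x :: 'a
    have pos: "q (c *\<^sub>R x) = c * q x" if "0 < c" for c x
    proof -
      have "q (c *\<^sub>R x) = q (c *\<^sub>R pprt x - c *\<^sub>R (- nprt x))"
        by (simp only: scaleR_diff_right[symmetric] dec(1)[symmetric])
      also have "\<dots> = p (c *\<^sub>R pprt x) - p (c *\<^sub>R (- nprt x))"
        using that dec(2)[of x] by (intro q_eq scaleR_nonneg_nonneg) auto
      also have "\<dots> = c * p (pprt x) - c * p (- nprt x)"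
        using that dec(2)[of x] by (simp only: p_scale zero_le_pprt)
      finally show ?thesis by (simp add: q_def right_diff_distrib)
    qed
    have neg: "q (- x) = - q x" for x
      by (simp add: q_def pprt_neg nprt_neg)
    show "q (c *\<^sub>R x) = c *\<^sub>R q x"
    proof (cases c "0::real" rule: linorder_cases)
      case less
      then have "q ((- c) *\<^sub>R (- x)) = (- c) * q (- x)" by (intro pos) simp
      then show ?thesis by (simp add: neg)
    next
      case equal
      then show ?thesis by (simp add: q_def p0)
    next
      case greater
      then show ?thesis by (simp add: pos)
    qed
  next
    fix x :: 'a
    have b: "0 \<le> p a \<and> p a \<le> norm f * norm x" if "0 \<le> a" "a \<le> \<bar>x\<bar>" for a
    proof
      show "0 \<le> p a" using ub[of 0 a] that by (simp add: f.zero)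
      have "norm a \<le> norm x" using that by (intro norm_mono_abs) simp
      then have "norm f * norm a \<le> norm f * norm x" by (intro mult_left_mono) auto
      then show "p a \<le> norm f * norm x"
        using that fb[of _ a] by (intro lub) (auto intro: order_trans)
    qed
    have "pprt x \<le> \<bar>x\<bar>" "- nprt x \<le> \<bar>x\<bar>"
      using dec(2)[of x] zero_le_pprt[of x] by (simp_all add: abs_prts algebra_simps)
    then show "norm (q x) \<le> norm x * norm f"
      using b[of "pprt x"] b[of "- nprt x"] dec(2)[of x]
      by (simp add: q_def mult.commute abs_le_iff)
  qed
  then obtain g where "dual_apply g = q" using ex_dual by blast
  then show ?thesis
    using q_pos ub lub by (intro exI[of _ g]) auto
qed

lemma pos_partE:
  fixes f :: "'a::banach_lattice dual"
  obtains p where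
    "\<And>x y. 0 \<le> y \<Longrightarrow> y \<le> x \<Longrightarrow> dual_apply f y \<le> dual_apply p x"
    "\<And>x c. 0 \<le> x \<Longrightarrow> (\<And>y. 0 \<le> y \<Longrightarrow> y \<le> x \<Longrightarrow> dual_apply f y \<le> c) \<Longrightarrow> dual_apply p x \<le> c"
proof -
  obtain p where p: "\<forall>x\<ge>0. (\<forall>y. 0 \<le> y \<and> y \<le> x \<longrightarrow> dual_apply f y \<le> dual_apply p x) \<and>
           (\<forall>c. (\<forall>y. 0 \<le> y \<and> y \<le> x \<longrightarrow> dual_apply f y \<le> c) \<longrightarrow> dual_apply p x \<le> c)"
    using ex_pos_part[of f] by (rule exE)
  show thesis
  proof (rule that)
    fix x y :: 'a assume y: "0 \<le> y" "y \<le> x"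
    then have "0 \<le> x" by (rule order_trans)
    with p y show "dual_apply f y \<le> dual_apply p x" by simp
  next
    fix x :: 'a and c assume "0 \<le> x" "\<And>y. 0 \<le> y \<Longrightarrow> y \<le> x \<Longrightarrow> dual_apply f y \<le> c"
    with p show "dual_apply p x \<le> c" by simp
  qed
qed

instantiation dual :: (banach_lattice) "{ord, sup, inf, abs}"
begin

definition less_eq_dual :: "'a dual \<Rightarrow> 'a dual \<Rightarrow> bool" where
  "f \<le> g \<longleftrightarrow> (\<forall>x\<ge>0. dual_apply f x \<le> dual_apply g x)"

definition less_dual :: "'a dual \<Rightarrow> 'a dual \<Rightarrow> bool" where
  "(f :: 'a dual) < g \<longleftrightarrow> f \<le> g \<and> \<not> g \<le> f"

text \<open>Least upper bounds exist by the Riesz--Kantorovich theorem (\<open>ex_pos_part\<close>,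
  \<open>dual_sup_lub\<close>).\<close>

definition sup_dual :: "'a dual \<Rightarrow> 'a dual \<Rightarrow> 'a dual" where
  "sup (f :: 'a dual) g = (THE h. f \<le> h \<and> g \<le> h \<and> (\<forall>k. f \<le> k \<and> g \<le> k \<longrightarrow> h \<le> k))"

definition inf_dual :: "'a dual \<Rightarrow> 'a dual \<Rightarrow> 'a dual" where
  "inf (f :: 'a dual) g = - sup (- f) (- g)"

definition abs_dual :: "'a dual \<Rightarrow> 'a dual" where
  "\<bar>f :: 'a dual\<bar> = sup f (- f)"

instance ..

end

instance dual :: (banach_lattice) ordered_real_vector
proof
  fix f g h :: "'a dual" and a b :: real
  show "f < g \<longleftrightarrow> f \<le> g \<and> \<not> g \<le> f" by (rule less_dual_def)
  show "f \<le> f" by (simp add: less_eq_dual_def)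
  show "f \<le> g \<Longrightarrow> g \<le> h \<Longrightarrow> f \<le> h"
    unfolding less_eq_dual_def by (meson order_trans)
  show "f = g" if "f \<le> g" "g \<le> f"
  proof (rule dual_eqI)
    fix x
    have eq: "dual_apply f y = dual_apply g y" if "0 \<le> y" for y
      using \<open>f \<le> g\<close> \<open>g \<le> f\<close> that unfolding less_eq_dual_def by (meson antisym)
    have lin: "linear (dual_apply k)" for k :: "'a dual"
      by (rule bounded_linear.linear[OF bounded_linear_dual_apply])
    have "dual_apply f (pprt x - (- nprt x)) = dual_apply g (pprt x - (- nprt x))"
      using eq[of "pprt x"] eq[of "- nprt x"] by (simp only: linear_diff[OF lin]) simp
    then show "dual_apply f x = dual_apply g x"
      using prts[of x] by simp
  qed
  show "f \<le> g \<Longrightarrow> h + f \<le> h + g" by (simp add: less_eq_dual_def)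
  show "f \<le> g \<Longrightarrow> 0 \<le> a \<Longrightarrow> a *\<^sub>R f \<le> a *\<^sub>R g"
    by (simp add: less_eq_dual_def mult_left_mono)
  show "a \<le> b \<Longrightarrow> 0 \<le> f \<Longrightarrow> a *\<^sub>R f \<le> b *\<^sub>R f"
    by (simp add: less_eq_dual_def mult_right_mono)
qed

lemma dual_sup_lub:
  fixes f g :: "'a::banach_lattice dual"
  shows "f \<le> sup f g \<and> g \<le> sup f g \<and> (\<forall>k. f \<le> k \<and> g \<le> k \<longrightarrow> sup f g \<le> k)"
proof -
  obtain p where p: "\<And>x y. 0 \<le> y \<Longrightarrow> y \<le> x \<Longrightarrow> dual_apply (f - g) y \<le> dual_apply p x"
      "\<And>x c. 0 \<le> x \<Longrightarrow> (\<And>y. 0 \<le> y \<Longrightarrow> y \<le> x \<Longrightarrow> dual_apply (f - g) y \<le> c) \<Longrightarrow> dual_apply p x \<le> c"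
    using pos_partE[of "f - g"] by blast
  have "g + p \<le> k" if k: "f \<le> k" "g \<le> k" for k
    unfolding less_eq_dual_def
  proof (intro allI impI)
    fix x :: 'a assume "0 \<le> x"
    have "dual_apply p x \<le> dual_apply (k - g) x"
    proof (rule p(2)[OF \<open>0 \<le> x\<close>])
      fix y assume y: "0 \<le> y" "y \<le> x"
      have "dual_apply (f - g) y \<le> dual_apply (k - g) y"
        using k y by (simp add: less_eq_dual_def)
      moreover have "dual_apply (k - g) (x - y) \<ge> 0"
        using k y by (simp add: less_eq_dual_def)
      moreover have "dual_apply (k - g) (x - y) = dual_apply (k - g) x - dual_apply (k - g) y"
        by (rule linear_diff[OF bounded_linear.linear[OF bounded_linear_dual_apply]])
      ultimately show "dual_apply (f - g) y \<le> dual_apply (k - g) x" by linarith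
    qed
    then show "dual_apply (g + p) x \<le> dual_apply k x" by simp
  qed
  moreover have "f \<le> g + p"
    unfolding less_eq_dual_def using p(1) by (fastforce simp: algebra_simps)
  moreover have "g \<le> g + p"
    unfolding less_eq_dual_def using p(1)[of 0] by simp
  ultimately have "\<exists>!h. f \<le> h \<and> g \<le> h \<and> (\<forall>k. f \<le> k \<and> g \<le> k \<longrightarrow> h \<le> k)"
    by (intro ex1I[of _ "g + p"]) (auto intro: antisym)
  from theI'[OF this] show ?thesis unfolding sup_dual_def .
qed

instance dual :: (banach_lattice) lattice_ab_group_add_abs
proof
  fix f g h :: "'a dual"
  show "f \<le> sup f g" "g \<le> sup f g" using dual_sup_lub by blast+
  show "g \<le> f \<Longrightarrow> h \<le> f \<Longrightarrow> sup g h \<le> f" using dual_sup_lub by blast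
  show "inf f g \<le> f" "inf f g \<le> g"
    unfolding inf_dual_def using dual_sup_lub[of "- f" "- g"] by (auto simp: minus_le_iff)
  show "f \<le> inf g h" if "f \<le> g" "f \<le> h"
  proof -
    have "- g \<le> - f" "- h \<le> - f" using that by simp_all
    then have "sup (- g) (- h) \<le> - f" using dual_sup_lub by blast
    then show ?thesis unfolding inf_dual_def by (simp add: le_minus_iff)
  qed
  show "\<bar>f\<bar> = sup f (- f)" by (rule abs_dual_def)
qed

lemma dual_apply_mono: "f \<le> g \<Longrightarrow> 0 \<le> x \<Longrightarrow> dual_apply f x \<le> dual_apply g x"
  by (simp add: less_eq_dual_def)

lemma dual_apply_le_abs: "\<bar>dual_apply f x\<bar> \<le> dual_apply \<bar>f\<bar> \<bar>x\<bar>"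
proof -
  have lin: "linear (dual_apply k)" for k :: "'a dual"
    by (rule bounded_linear.linear[OF bounded_linear_dual_apply])
  have x: "0 \<le> pprt x" "0 \<le> - nprt x" "x = pprt x - (- nprt x)" "\<bar>x\<bar> = pprt x + (- nprt x)"
    using prts[of x] by (simp_all add: abs_prts)
  have b: "\<bar>dual_apply f y\<bar> \<le> dual_apply \<bar>f\<bar> y" if "0 \<le> y" for y
    using dual_apply_mono[OF abs_ge_self[of f] that] dual_apply_mono[OF abs_ge_minus_self[of f] that]
    by simp
  have "dual_apply f x = dual_apply f (pprt x) - dual_apply f (- nprt x)"
    using x(3) linear_diff[OF lin] by metis
  moreover have "dual_apply \<bar>f\<bar> \<bar>x\<bar> = dual_apply \<bar>f\<bar> (pprt x) + dual_apply \<bar>f\<bar> (- nprt x)"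
    using x(4) linear_add[OF lin] by metis
  ultimately show ?thesis
    using b[OF x(1)] b[OF x(2)] by linarith
qed

lemma dual_abs_apply_le:
  fixes f :: "'a::banach_lattice dual"
  assumes "0 \<le> x"
  shows "dual_apply \<bar>f\<bar> x \<le> norm f * norm x"
proof -
  have lin: "linear (dual_apply k)" for k :: "'a dual"
    by (rule bounded_linear.linear[OF bounded_linear_dual_apply])
  obtain p where p: "\<And>x y. 0 \<le> y \<Longrightarrow> y \<le> x \<Longrightarrow> dual_apply f y \<le> dual_apply p x"
      "\<And>x c. 0 \<le> x \<Longrightarrow> (\<And>y. 0 \<le> y \<Longrightarrow> y \<le> x \<Longrightarrow> dual_apply f y \<le> c) \<Longrightarrow> dual_apply p x \<le> c"
    using pos_partE[of f] by blast
  have "f \<le> 2 *\<^sub>R p - f"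
    unfolding less_eq_dual_def using p(1) by fastforce
  moreover have "- f \<le> 2 *\<^sub>R p - f"
    unfolding less_eq_dual_def using p(1)[of 0] by simp
  ultimately have "\<bar>f\<bar> \<le> 2 *\<^sub>R p - f"
    unfolding abs_dual_def by (rule sup_least)
  then have "dual_apply \<bar>f\<bar> x \<le> 2 * dual_apply p x - dual_apply f x"
    using dual_apply_mono[OF _ assms] by fastforce
  moreover have "dual_apply p x \<le> (norm f * norm x + dual_apply f x) / 2"
  proof (rule p(2)[OF assms])
    fix y assume y: "0 \<le> y" "y \<le> x"
    have "y + y - x \<le> x" "x - (y + y) \<le> x"
      using y by (auto simp: algebra_simps intro: add_mono)
    then have "norm (y + y - x) \<le> norm x"
      using assms by (intro norm_mono_abs) (simp add: abs_le_iff)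
    then have "dual_apply f (y + y - x) \<le> norm f * norm x"
      using norm_dual_apply[of f "y + y - x"]
      by (meson abs_ge_self mult_left_mono norm_ge_zero order_trans)
    then show "dual_apply f y \<le> (norm f * norm x + dual_apply f x) / 2"
      by (simp add: linear_diff[OF lin] linear_add[OF lin])
  qed
  ultimately show ?thesis by simp
qed

instance dual :: (banach_lattice) banach_lattice
proof
  fix f g :: "'a dual"
  assume fg: "\<bar>f\<bar> \<le> \<bar>g\<bar>"
  show "norm f \<le> norm g"
  proof (rule norm_dual_bound)
    fix x :: 'a
    have "\<bar>dual_apply f x\<bar> \<le> dual_apply \<bar>f\<bar> \<bar>x\<bar>" by (rule dual_apply_le_abs)
    also have "\<dots> \<le> dual_apply \<bar>g\<bar> \<bar>x\<bar>" using fg by (rule dual_apply_mono) simp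
    also have "\<dots> \<le> norm g * norm \<bar>x\<bar>" by (rule dual_abs_apply_le) simp
    also have "norm \<bar>x\<bar> = norm x" by (intro antisym norm_mono_abs) simp_all
    finally show "\<bar>dual_apply f x\<bar> \<le> norm g * norm x" .
  qed simp
qed

text \<open>\<open>\<sigma>(E', E)\<close>: the initial topology for the evaluations; \<open>euclidean\<close> on \<open>'a \<Rightarrow> real\<close> is the
  product topology.\<close>

definition weak_star_topology :: "'a::banach_lattice dual topology" where
  "weak_star_topology = pullback_topology UNIV dual_apply euclidean"

lemma limitin_weak_star_iff:
  "limitin weak_star_topology f l F \<longleftrightarrow> (\<forall>x. ((\<lambda>n. dual_apply (f n) x) \<longlongrightarrow> dual_apply l x) F)"
proof -
  have "limitin weak_star_topology f l F \<longleftrightarrow> ((\<lambda>n. dual_apply (f n)) \<longlongrightarrow> dual_apply l) F"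
    unfolding limitin_def weak_star_topology_def topspace_pullback_topology
      openin_pullback_topology tendsto_def by auto
  also have "\<dots> \<longleftrightarrow> (\<forall>x. ((\<lambda>n. dual_apply (f n) x) \<longlongrightarrow> dual_apply l x) F)"
    using limitin_componentwise[of "\<lambda>_. euclidean" UNIV "\<lambda>n. dual_apply (f n)" "dual_apply l" F]
    by (simp add: euclidean_product_topology)
  finally show ?thesis .
qed

end

theory Submission
  imports Defs
begin

text \<open>Statement (1) says that order bounded disjoint sequences are norm null. Given (1), the
  increments \<open>u n\<close> of a decreasing positive sequence tend to \<open>0\<close> in norm: since their sums are at
  most \<open>d 0\<close>, any \<open>K\<close> of the elements \<open>(K u n - d 0)\<^sup>+\<close> have infimum \<open>0\<close>, and induction on \<open>K\<close>
  reduces such sequences to disjoint ones. So decreasing sequences in the positive cone converge, which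
  gives (2). Applied to elements of \<open>{0..x}\<close> on which disjoint functionals are nearly concentrated, the
  same convergence gives (3). Conversely, disjoint positive elements are normed by disjoint
  functionals, namely the parts of Hahn-Banach functionals carried by the bands they generate.\<close>

section \<open>Disjoint sequences in order intervals\<close>

text \<open>The obstacle is that \<open>'a\<close> need not be Dedekind complete: neither band
  projections nor suprema of bounded increasing sequences are at hand. Disjoint elements are
  therefore cut out by positive parts, which are disjoint for \<open>a\<close> and \<open>b\<close>
  as soon as \<open>a + b \<le> 0\<close>, and a supremum or infinite sum that may be missing is
  replaced by a norm limit of positive parts. The factor \<open>K\<close> is dictated by the norm:
  if \<open>norm (u n) \<ge> e\<close>, then \<open>real K *\<^sub>R u n - d 0\<close> has norm at
  least \<open>real K * e - norm (d 0)\<close>, so a large \<open>K\<close> keeps the positive parts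
  away from \<open>0\<close>. Statement (2) is compared with (1) directly, whereas (3) and (4) enter
  through the cycle (1), (3), (4), (1).\<close>

lemma inf_add_le_add_inf:
  fixes z a b :: "'a::lattice_ab_group_add"
  assumes "0 \<le> z" "0 \<le> a" "0 \<le> b"
  shows "inf z (a + b) \<le> inf z a + inf z b"
proof -
  have eq: "inf z a + inf z b = inf (inf (z + z) (a + z)) (inf (z + b) (a + b))"
    by (simp only: add_inf_distrib_left add_inf_distrib_right)
  have "z \<le> z + z" "z \<le> a + z" "z \<le> z + b"
    using assms by (simp_all add: add_increasing add_increasing2)
  then show ?thesis unfolding eq by (simp add: le_infI1)
qed

lemma inf_sum_eq_0:
  fixes z :: "'a::lattice_ab_group_add"
  assumes "0 \<le> z" "\<And>i. i \<in> F \<Longrightarrow> 0 \<le> a i" "\<And>i. i \<in> F \<Longrightarrow> inf z (a i) = 0"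
  shows "inf z (sum a F) = 0"
  using assms
proof (induction F rule: infinite_finite_induct)
  case (insert i F)
  have "inf z (a i + sum a F) \<le> inf z (a i) + inf z (sum a F)"
    using insert.prems by (intro inf_add_le_add_inf sum_nonneg) auto
  also have "\<dots> = 0" using insert by simp
  finally have "inf z (a i + sum a F) \<le> 0" .
  moreover have "0 \<le> inf z (a i + sum a F)"
    using insert.prems by (simp add: sum_nonneg add_nonneg_nonneg)
  ultimately show ?case using insert.hyps by (simp add: antisym)
qed (simp_all add: inf_absorb2)

lemma inf_eq_0_mono:
  fixes a b c d :: "'a::lattice_ab_group_add"
  assumes "inf c d = 0" "0 \<le> a" "a \<le> c" "0 \<le> b" "b \<le> d"
  shows "inf a b = 0"
  using assms by (metis antisym inf_mono le_inf_iff)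

lemma inf_pprt_uminus:
  fixes a :: "'a::lattice_ab_group_add"
  shows "inf (pprt a) (- nprt a) = 0"
proof -
  have "inf (pprt a) (- nprt a) = inf (a + - nprt a) (0 + - nprt a)"
    using prts[of a] by (metis add_0 add_diff_cancel_right' diff_conv_add_uminus)
  also have "\<dots> = inf a 0 + - nprt a" by (simp only: add_inf_distrib_right)
  also have "\<dots> = 0" by (simp flip: nprt_def)
  finally show ?thesis .
qed

text \<open>From \<open>b \<le> - a\<close>, the element \<open>pprt b\<close> lies below the
  negative part \<open>- nprt a\<close>, which is disjoint from \<open>pprt a\<close>. The uses have
  \<open>b = - a\<close>, with two elements bounded by these positive parts.\<close>

lemma inf_pprt_eq_0:
  fixes a b :: "'a::lattice_ab_group_add"
  assumes "a + b \<le> 0"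
  shows "inf (pprt a) (pprt b) = 0"
proof (rule inf_eq_0_mono[OF inf_pprt_uminus])
  have "b \<le> - a" using assms by (simp add: le_eq_neg add.commute)
  then show "pprt b \<le> - nprt a" by (metis pprt_mono pprt_neg)
qed auto

lemma pprt_diff_eq: "pprt (a - b) = a - inf a (b::'a::lattice_ab_group_add)"
proof -
  have "a - inf a b = a + sup (- a) (- b)" by (rule diff_inf_eq_sup)
  also have "\<dots> = sup 0 (a - b)" by (simp add: add_sup_distrib_left)
  finally show ?thesis by (simp add: pprt_def sup_commute)
qed

section \<open>Norm estimates for positive parts and closedness of the positive cone\<close>

lemma norm_abs [simp]: "norm \<bar>x\<bar> = norm (x::'a::banach_lattice)"
  by (intro antisym norm_mono_abs) simp_all

lemma pprt_le_abs: "pprt x \<le> \<bar>x::'a::lattice_ab_group_add_abs\<bar>"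
  by (simp add: pprt_def abs_ge_self)

lemma norm_pprt_le: "norm (pprt x) \<le> norm (x::'a::banach_lattice)"
  using norm_mono_pos[OF zero_le_pprt pprt_le_abs[of x]] by simp

lemma pprt_add_le: "pprt (a + b) \<le> pprt a + pprt (b::'a::lattice_ab_group_add)"
  unfolding pprt_def[of "a + b"]
  by (intro sup_least add_mono) (auto simp: pprt_def intro: add_nonneg_nonneg)

lemma norm_pprt_diff_le: "norm (pprt x - pprt y) \<le> norm (x - y::'a::banach_lattice)"
proof (rule norm_mono_abs)
  have le: "pprt x - pprt y \<le> \<bar>x - y\<bar>" for x y :: 'a
    using pprt_add_le[of "x - y" y] pprt_le_abs[of "x - y"]
    by (simp add: diff_le_eq) (meson add_right_mono order_trans)
  show "\<bar>pprt x - pprt y\<bar> \<le> \<bar>x - y\<bar>"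
    using le[of x y] le[of y x] by (intro abs_leI) (simp_all add: abs_minus_commute)
qed

text \<open>\<open>X n \<ge> 0\<close> forces \<open>pprt (- l) \<le> pprt (X n - l)\<close>, so the
  negative part of \<open>l\<close> is no larger in norm than the distance from \<open>X n\<close>
  to \<open>l\<close>.\<close>

lemma nonneg_limit:
  fixes X :: "nat \<Rightarrow> 'a::banach_lattice"
  assumes "X \<longlonglongrightarrow> l" "\<And>n. n \<ge> N \<Longrightarrow> 0 \<le> X n"
  shows "0 \<le> l"
proof -
  have "norm (pprt (- l)) \<le> norm (X n - l)" if "n \<ge> N" for n
  proof -
    have "pprt (- l) \<le> pprt (X n - l)" using assms(2)[OF that] by (intro pprt_mono) simp
    then show ?thesis by (metis norm_mono_pos norm_pprt_le order_trans zero_le_pprt)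
  qed
  moreover have "(\<lambda>n. norm (X n - l)) \<longlonglongrightarrow> 0"
    using assms(1) by (simp add: LIM_zero tendsto_norm_zero)
  ultimately have "norm (pprt (- l)) \<le> 0"
    by (intro LIMSEQ_le_const[of "\<lambda>n. norm (X n - l)"]) auto
  then have "pprt (- l) = 0" by simp
  then show ?thesis by (simp add: le_zero_iff_zero_pprt[symmetric])
qed

lemma limit_mono:
  fixes X Y :: "nat \<Rightarrow> 'a::banach_lattice"
  assumes "X \<longlonglongrightarrow> l" "Y \<longlonglongrightarrow> m" "\<And>n. n \<ge> N \<Longrightarrow> X n \<le> Y n"
  shows "l \<le> m"
  using nonneg_limit[OF tendsto_diff[OF assms(2,1)], of N] assms(3) by simp

text \<open>Dividing by \<open>Suc k\<close> bounds \<open>l\<close> by a multiple of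
  \<open>w\<close> that tends to \<open>0\<close> in norm, and the positive cone is closed.\<close>

lemma archimedean_banach_lattice:
  fixes l w :: "'a::banach_lattice"
  assumes "\<And>k::nat. real k *\<^sub>R l \<le> w"
  shows "l \<le> 0"
proof -
  have "l \<le> inverse (real (Suc k)) *\<^sub>R w" for k
  proof -
    have "inverse (real (Suc k)) *\<^sub>R (real (Suc k) *\<^sub>R l) \<le> inverse (real (Suc k)) *\<^sub>R w"
      using assms[of "Suc k"] by (intro scaleR_left_mono) auto
    then show ?thesis by simp
  qed
  moreover have "(\<lambda>k. inverse (real (Suc k)) *\<^sub>R w) \<longlonglongrightarrow> 0 *\<^sub>R w"
    by (intro tendsto_intros LIMSEQ_inverse_real_of_nat)
  ultimately show ?thesis using limit_mono[OF tendsto_const[of l]] by auto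
qed

lemma not_norm_tendsto_zero_subseq:
  fixes f :: "nat \<Rightarrow> 'a::real_normed_vector"
  assumes "\<not> (\<lambda>n. norm (f n)) \<longlonglongrightarrow> 0"
  obtains e r where "0 < e" "strict_mono (r :: nat \<Rightarrow> nat)" "\<forall>n. e \<le> norm (f (r n))"
proof -
  obtain e where e: "0 < e" "\<forall>N. \<exists>n\<ge>N. e \<le> norm (f n)"
    using assms unfolding lim_sequentially by (auto simp: not_less)
  then have "infinite {n. e \<le> norm (f n)}" unfolding infinite_nat_iff_unbounded_le by auto
  then obtain r where "strict_mono (r :: nat \<Rightarrow> nat)" "\<forall>n. r n \<in> {n. e \<le> norm (f n)}"
    using infinite_enumerate by blast
  with e(1) that show thesis by auto
qed

text \<open>Statement (1) stripped of the operator and the solid hull; all implications use or prove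
  it in this form. The bound \<open>\<bar>y n\<bar> \<le> x\<close> already forces
  \<open>0 \<le> x\<close>.\<close>

definition disjoint_null :: "'a::banach_lattice itself \<Rightarrow> bool" where
  "disjoint_null _ \<longleftrightarrow> (\<forall>x (y :: nat \<Rightarrow> 'a). disjoint_seq y \<and> (\<forall>n. \<bar>y n\<bar> \<le> x) \<longrightarrow>
     (\<lambda>n. norm (y n)) \<longlonglongrightarrow> 0)"

text \<open>The solid hull of \<open>{0..x}\<close> is \<open>{y. \<bar>y\<bar> \<le> x}\<close>,
  and monotonicity of the norm bounds the interval, so only the clause on disjoint sequences
  survives.\<close>

lemma order_L_weakly_compact_id_iff:
  "order_L_weakly_compact (id_blinfun :: 'a::banach_lattice \<Rightarrow>\<^sub>L 'a) \<longleftrightarrow> disjoint_null TYPE('a)"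
proof -
  have hull: "solid_hull {0..x} = {y. \<bar>y\<bar> \<le> x}" if "0 \<le> x" for x :: 'a
    using that unfolding solid_hull_def by (auto intro: order_trans)
  have bdd: "bounded {0..x}" for x :: 'a
    by (rule boundedI[of _ "norm x"]) (auto intro: norm_mono_pos)
  have pos: "0 \<le> x \<and> (\<forall>n. \<bar>y n\<bar> \<le> x) \<longleftrightarrow> (\<forall>n. \<bar>y n\<bar> \<le> x)" for x and y :: "nat \<Rightarrow> 'a"
    by (meson abs_ge_zero order_trans)
  have "order_L_weakly_compact (id_blinfun :: 'a \<Rightarrow>\<^sub>L 'a) \<longleftrightarrow>
      (\<forall>x (y :: nat \<Rightarrow> 'a). disjoint_seq y \<and> 0 \<le> x \<and> (\<forall>n. \<bar>y n\<bar> \<le> x) \<longrightarrow>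
         (\<lambda>n. norm (y n)) \<longlonglongrightarrow> 0)"
    unfolding order_L_weakly_compact_def L_weakly_compact_def
    using bdd by (auto simp: hull image_subset_iff id_blinfun.rep_eq)
  then show ?thesis unfolding disjoint_null_def pos .
qed

lemma disjoint_nullD:
  fixes v :: "nat \<Rightarrow> 'a::banach_lattice"
  assumes "disjoint_null TYPE('a)" "\<And>n. 0 \<le> v n" "\<And>n. v n \<le> x"
    "\<And>m n. m < n \<Longrightarrow> inf (v m) (v n) = 0"
  shows "(\<lambda>n. norm (v n)) \<longlonglongrightarrow> 0"
proof -
  have "disjoint_seq v"
    unfolding disjoint_seq_def using assms(2,4) by (metis abs_of_nonneg inf_commute linorder_neqE_nat)
  then show ?thesis
    using assms(1-3) unfolding disjoint_null_def by (metis abs_of_nonneg)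
qed

text \<open>Along a subsequence with small overlaps, the positive parts of \<open>w n\<close> minus all its overlaps
  with other members are disjoint and close to \<open>w n\<close> in norm.\<close>

lemma almost_disjoint_null:
  fixes w :: "nat \<Rightarrow> 'a::banach_lattice"
  assumes null: "disjoint_null TYPE('a)" and w: "\<And>n. 0 \<le> w n" "\<And>n. w n \<le> x"
    and ov: "\<And>m. (\<lambda>n. norm (inf (w m) (w n))) \<longlonglongrightarrow> 0"
  shows "(\<lambda>n. norm (w n)) \<longlonglongrightarrow> 0"
proof (rule ccontr)
  assume "\<not> ?thesis"
  then obtain e s where e: "0 < e" and s: "strict_mono (s :: nat \<Rightarrow> nat)" "\<forall>n. e \<le> norm (w (s n))"
    by (rule not_norm_tendsto_zero_subseq) blast
  define b where "b m n = norm (inf (w (s m)) (w (s n)))" for m n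
  have b0: "b m \<longlonglongrightarrow> 0" for m
    using LIMSEQ_subseq_LIMSEQ[OF ov[of "s m"] s(1)] unfolding b_def comp_def .
  \<comment> \<open>Each new member overlaps every member with index up to \<open>r n\<close> by
    less than \<open>e / 8 * (1/4) ^ Suc n\<close>. Powers of \<open>1/4\<close> are taken because
    \<open>(1/4) ^ n \<le> (1/2) ^ n * (1/2) ^ m\<close> for \<open>m < n\<close> turns this into a
    bound symmetric in \<open>m\<close> and \<open>n\<close>; each row of overlaps then sums to at
    most \<open>e / 4\<close>, while \<open>norm (u n) \<ge> e\<close>.\<close>
  have "\<exists>r. \<forall>n. True \<and> r n < r (Suc n) \<and> (\<forall>m\<le>r n. b m (r (Suc n)) < e / 8 * (1/4) ^ Suc n)"
  proof (rule dependent_nat_choice)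
    fix k n :: nat
    have "\<forall>m\<in>{..k}. \<forall>\<^sub>F j in sequentially. b m j < e / 8 * (1/4) ^ Suc n"
      using e by (intro ballI order_tendstoD(2)[OF b0]) simp
    then have "\<forall>\<^sub>F j in sequentially. \<forall>m\<in>{..k}. b m j < e / 8 * (1/4) ^ Suc n"
      by (intro eventually_ball_finite) auto
    with eventually_gt_at_top[of k]
    have "\<forall>\<^sub>F j in sequentially. k < j \<and> (\<forall>m\<in>{..k}. b m j < e / 8 * (1/4) ^ Suc n)"
      by (rule eventually_conj)
    then show "\<exists>j. True \<and> k < j \<and> (\<forall>m\<le>k. b m j < e / 8 * (1/4) ^ Suc n)"
      using eventually_happens' sequentially_bot by fastforce
  qed simp
  then obtain r where r: "\<And>n. r n < r (Suc n)"
      "\<And>n m. m \<le> r n \<Longrightarrow> b m (r (Suc n)) < e / 8 * (1/4) ^ Suc n" by blast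
  have rm: "strict_mono r" using r(1) by (simp add: strict_mono_Suc_iff)
  define u where "u n = w (s (r n))" for n
  have u: "0 \<le> u n" "u n \<le> x" "e \<le> norm (u n)" for n
    unfolding u_def using w s by simp_all
  have lt: "norm (inf (u m) (u n)) \<le> e / 8 * (1/2) ^ n * (1/2) ^ m" if mn: "m < n" for m n
  proof -
    obtain k where k: "n = Suc k" using mn by (cases n) auto
    then have "r m \<le> r k" using mn rm by (simp add: strict_mono_less_eq)
    then have "norm (inf (u m) (u n)) \<le> e / 8 * (1/4) ^ n"
      using r(2)[of "r m" k] k by (simp add: b_def u_def)
    also have "(1/4::real) ^ n = (1/2) ^ n * (1/2) ^ n"
      by (simp add: power_mult_distrib[symmetric])
    also have "e / 8 * \<dots> \<le> e / 8 * ((1/2) ^ n * (1/2) ^ m)"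
      using e mn by (intro mult_left_mono power_decreasing) auto
    finally show ?thesis by simp
  qed
  \<comment> \<open>The diagonal is \<open>0\<close> because the overlap of \<open>u n\<close> with
    itself is \<open>u n\<close> and would annihilate \<open>v n\<close>.\<close>
  define a where "a n m = (if m = n then 0 else inf (u n) (u m))" for n m
  have a_pos: "0 \<le> a n m" for n m using u by (simp add: a_def)
  have a_le: "norm (a n m) \<le> e / 8 * (1/2) ^ n * (1/2) ^ m" for n m
    using lt[of m n] lt[of n m] e
    by (cases m n rule: linorder_cases) (simp_all add: a_def inf_commute mult_ac)
  have geo: "(\<lambda>m. e / 8 * (1/2) ^ n * (1/2) ^ m) sums (e / 8 * (1/2) ^ n * 2)" for n
    using sums_mult[OF geometric_sums[of "1/2::real"], of "e / 8 * (1/2) ^ n"] by simp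
  have na: "summable (\<lambda>m. norm (a n m))" for n
    by (rule summable_comparison_test'[OF sums_summable[OF geo[of n]], of 0])
      (simp only: real_norm_def abs_norm_cancel a_le)
  have term_le: "a n m \<le> (\<Sum>k. a n k)" for n m
  proof (rule limit_mono[OF tendsto_const, of _ _ "Suc m"])
    show "(\<lambda>N. \<Sum>k<N. a n k) \<longlonglongrightarrow> (\<Sum>k. a n k)"
      using summable_LIMSEQ[OF summable_norm_cancel[OF na]] .
    show "a n m \<le> (\<Sum>k<N. a n k)" if "N \<ge> Suc m" for N
      using that a_pos sum_mono2[of "{..<N}" "{m}" "a n"] by simp
  qed
  have sum_le: "norm (\<Sum>k. a n k) \<le> e / 4" for n
  proof -
    have "norm (\<Sum>k. a n k) \<le> (\<Sum>k. norm (a n k))" by (rule summable_norm[OF na])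
    also have "\<dots> \<le> e / 8 * (1/2) ^ n * 2"
      unfolding sums_unique[OF geo[of n]]
      by (rule suminf_le[OF a_le na sums_summable[OF geo]])
    also have "\<dots> \<le> e / 8 * 1 * 2"
      using e by (intro mult_right_mono mult_left_mono power_le_one) auto
    finally show ?thesis by simp
  qed
  define v where "v n = pprt (u n - (\<Sum>k. a n k))" for n
  have a_eq: "a n m = inf (u n) (u m)" if "m \<noteq> n" for m n using that by (simp add: a_def)
  \<comment> \<open>Keeping a single overlap of the series already gives
    \<open>pprt (u n - u m)\<close>. With \<open>m\<close> and \<open>n\<close> exchanged,
    \<open>v m\<close> lies below the positive part of the opposite element.\<close>
  have v_le: "v n \<le> pprt (u n - u m)" if "m \<noteq> n" for m n
  proof -
    have "v n \<le> pprt (u n - inf (u n) (u m))"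
      unfolding v_def using term_le[of n m] by (intro pprt_mono diff_left_mono) (simp only: a_eq[OF that])
    also have "\<dots> = pprt (u n - u m)" by (simp only: pprt_diff_eq[symmetric] pprt_eq_id[OF zero_le_pprt])
    finally show ?thesis .
  qed
  have "(\<lambda>n. norm (v n)) \<longlonglongrightarrow> 0"
  proof (rule disjoint_nullD[OF null])
    show "0 \<le> v n" for n by (simp add: v_def)
    show "v n \<le> x" for n
    proof -
      have "v n \<le> pprt (u n - u (Suc n))" by (rule v_le) simp
      also have "\<dots> \<le> pprt (u n)" using u by (intro pprt_mono) simp
      also have "\<dots> \<le> x" using u by simp
      finally show ?thesis .
    qed
    show "inf (v m) (v n) = 0" if "m < n" for m n
      using that v_le[of n m] v_le[of m n]
      by (intro inf_eq_0_mono[OF inf_pprt_eq_0[of "u m - u n" "u n - u m"]]) (auto simp: v_def)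
  qed
  moreover have "e / 2 \<le> norm (v n)" for n
  proof -
    have "u n = pprt (u n)" using u by simp
    then have "norm (u n - v n) \<le> norm (\<Sum>k. a n k)"
      unfolding v_def using norm_pprt_diff_le[of "u n" "u n - (\<Sum>k. a n k)"] by simp
    then have "norm (u n - v n) \<le> e / 4" using sum_le[of n] by linarith
    then show ?thesis using u(3)[of n] norm_triangle_sub[of "u n" "v n"] e by linarith
  qed
  ultimately have "e / 2 \<le> 0" by (intro LIMSEQ_le_const) auto
  with e show False by simp
qed

text \<open>Induction on the number \<open>K\<close> of members that cannot have a common nonzero
  minorant in \<open>{0..y}\<close>. If this holds for \<open>Suc K\<close> members, then below
  \<open>inf y (w m)\<close> it holds for any \<open>K\<close> members other than
  \<open>w m\<close>. By induction the overlaps with \<open>w m\<close> tend to \<open>0\<close>,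
  and bounded positive sequences with vanishing overlaps are null. For \<open>K = 0\<close> the
  empty set gives \<open>y = 0\<close>.\<close>

lemma finitely_overlapping_null:
  fixes w :: "nat \<Rightarrow> 'a::banach_lattice"
  assumes null: "disjoint_null TYPE('a)" and "\<And>n. 0 \<le> w n" "0 \<le> y"
    and "\<And>F z. finite F \<Longrightarrow> card F = K \<Longrightarrow> 0 \<le> z \<Longrightarrow> z \<le> y \<Longrightarrow> (\<And>n. n \<in> F \<Longrightarrow> z \<le> w n) \<Longrightarrow> z = 0"
  shows "(\<lambda>n. norm (inf y (w n))) \<longlonglongrightarrow> 0"
  using assms(2-)
proof (induction K arbitrary: w y)
  case 0
  have "y = 0" using 0(3)[of "{}" y] 0(2) by simp
  then show ?case using 0(1) by (simp add: inf_absorb1)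
next
  case (Suc K)
  show ?case
  proof (rule almost_disjoint_null[OF null])
    show "0 \<le> inf y (w n)" "inf y (w n) \<le> y" for n using Suc.prems by simp_all
    fix m
    \<comment> \<open>\<open>w m\<close> overlaps itself, so it is zeroed: a set \<open>F\<close>
      containing \<open>m\<close> then forces \<open>z = 0\<close>, and any other extends to
      \<open>insert m F\<close>. One changed term does not affect the limit.\<close>
    define w' where "w' n = (if n = m then 0 else w n)" for n
    have "(\<lambda>n. norm (inf (inf y (w m)) (w' n))) \<longlonglongrightarrow> 0"
    proof (rule Suc.IH)
      show "0 \<le> w' n" for n using Suc.prems by (simp add: w'_def)
      show "0 \<le> inf y (w m)" using Suc.prems by simp
      fix F z assume F: "finite F" "card F = K" "0 \<le> z" "z \<le> inf y (w m)" "\<And>n. n \<in> F \<Longrightarrow> z \<le> w' n"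
      show "z = 0"
      proof (cases "m \<in> F")
        case True
        with F(3) F(5)[of m] show ?thesis by (simp add: w'_def)
      next
        case False
        then show ?thesis
          using F Suc.prems(3)[of "insert m F" z] by (fastforce simp: w'_def split: if_splits)
      qed
    qed
    then show "(\<lambda>n. norm (inf (inf y (w m)) (inf y (w n)))) \<longlonglongrightarrow> 0"
    proof (rule Lim_transform_eventually)
      show "\<forall>\<^sub>F n in sequentially.
          norm (inf (inf y (w m)) (w' n)) = norm (inf (inf y (w m)) (inf y (w n)))"
        using eventually_gt_at_top[of m]
        by eventually_elim (simp add: w'_def inf_left_commute inf_assoc)
    qed
  qed
qed

section \<open>Monotone sequences and order continuity\<close>

lemma decreasing_differences_null:
  fixes d :: "nat \<Rightarrow> 'a::banach_lattice"
  assumes null: "disjoint_null TYPE('a)" and d: "\<And>n. 0 \<le> d n" "\<And>n. d (Suc n) \<le> d n"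
  shows "(\<lambda>n. norm (d n - d (Suc n))) \<longlonglongrightarrow> 0"
proof (rule ccontr)
  assume "\<not> ?thesis"
  then obtain e r where e: "0 < e" and r: "strict_mono (r :: nat \<Rightarrow> nat)"
      and er: "\<forall>n. e \<le> norm (d (r n) - d (Suc (r n)))"
    by (rule not_norm_tendsto_zero_subseq) blast
  define u where "u n = d (r n) - d (Suc (r n))" for n
  have u: "0 \<le> u n" for n using d by (simp add: u_def)
  have sum_u: "sum u F \<le> d 0" if "finite F" for F
  proof -
    have "finite (r ` F)" using that by simp
    then obtain N where N: "r ` F \<subseteq> {..<N}" by (auto simp only: finite_nat_iff_bounded)
    have "sum u F = (\<Sum>k\<in>r ` F. d k - d (Suc k))"
      using r by (simp add: u_def sum.reindex strict_mono_imp_inj_on)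
    also have "\<dots> \<le> (\<Sum>k<N. d k - d (Suc k))"
      using N d by (intro sum_mono2) auto
    also have "\<dots> = d 0 - d N" by (rule sum_lessThan_telescope')
    also have "\<dots> \<le> d 0" using d by simp
    finally show ?thesis .
  qed
  \<comment> \<open>\<open>K\<close> is so large that \<open>real K * e - norm (d 0)\<close>, a
    lower bound for \<open>norm (w n)\<close>, is at least \<open>1\<close>. The \<open>Suc\<close>
    below secures \<open>1 \<le> K\<close>, needed for
    \<open>z \<le> real K *\<^sub>R z\<close>.\<close>
  obtain K0 where K0: "norm (d 0) + 1 \<le> real K0 * e"
    using e ex_less_of_nat_mult[of e "norm (d 0) + 1"] by (metis less_imp_le)
  define K where "K = Suc K0"
  have K: "norm (d 0) + 1 \<le> real K * e" "1 \<le> K"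
    using K0 e by (auto simp: K_def algebra_simps)
  define a where "a n = real K *\<^sub>R u n - d 0" for n
  define w where "w n = pprt (a n)" for n
  have "(\<lambda>n. norm (inf (real K *\<^sub>R d 0) (w n))) \<longlonglongrightarrow> 0"
  proof (rule finitely_overlapping_null[OF null])
    show "0 \<le> w n" for n by (simp add: w_def)
    show "0 \<le> real K *\<^sub>R d 0" using d by (simp add: scaleR_nonneg_nonneg)
    fix F z
    assume F: "finite F" "card F = K" and z: "0 \<le> z" "\<And>n. n \<in> F \<Longrightarrow> z \<le> w n"
    \<comment> \<open>A common minorant \<open>z\<close> of the \<open>w n\<close> is disjoint from
      each negative part \<open>b n\<close>, hence from their sum. But
      \<open>sum a F \<le> 0\<close> gives \<open>sum w F \<le> sum b F\<close>, so \<open>z\<close>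
      also lies below that sum and must vanish.\<close>
    define b where "b n = - nprt (a n)" for n
    have "sum a F = real K *\<^sub>R sum u F - real K *\<^sub>R d 0"
      using F by (simp add: a_def sum_subtractf scaleR_sum_right sum_constant_scaleR)
    also have "\<dots> \<le> 0" using sum_u[OF F(1)] by (simp add: scaleR_left_mono)
    finally have a: "sum a F \<le> 0" .
    have b: "0 \<le> b n" for n by (simp add: b_def)
    have "inf z (b n) = 0" if "n \<in> F" for n
      using z(2)[OF that] by (intro inf_eq_0_mono[OF inf_pprt_uminus[of "a n"] z(1)])
        (simp_all add: b_def w_def)
    then have "inf z (sum b F) = 0" by (intro inf_sum_eq_0 z b)
    moreover have "z \<le> sum b F"
    proof -
      have "1 *\<^sub>R z \<le> real K *\<^sub>R z" using K z by (intro scaleR_right_mono) auto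
      also have "\<dots> = (\<Sum>n\<in>F. z)" using F by (simp add: sum_constant_scaleR)
      also have "\<dots> \<le> sum w F" using z by (intro sum_mono)
      also have "\<dots> = sum a F + sum b F"
      proof -
        have "w n = a n + b n" for n using prts[of "a n"] by (simp add: w_def b_def algebra_simps)
        then show ?thesis by (simp add: sum.distrib)
      qed
      also have "\<dots> \<le> sum b F" using a by simp
      finally show ?thesis by simp
    qed
    ultimately show "z = 0" by (simp add: inf_absorb1)
  qed
  moreover have "1 \<le> norm (inf (real K *\<^sub>R d 0) (w n))" for n
  proof -
    \<comment> \<open>The cap \<open>real K *\<^sub>R d 0\<close> cuts nothing off, because
      \<open>w n \<le> real K *\<^sub>R u n\<close>.\<close>
    have "u n \<le> d 0" using sum_u[of "{n}"] by simp
    then have "real K *\<^sub>R u n \<le> real K *\<^sub>R d 0" by (intro scaleR_left_mono) auto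
    moreover have "w n \<le> real K *\<^sub>R u n"
      unfolding w_def a_def pprt_def using d u by (intro sup_least) (auto intro: scaleR_nonneg_nonneg)
    ultimately have eq: "inf (real K *\<^sub>R d 0) (w n) = w n"
      by (meson inf_absorb2 order_trans)
    have "real K *\<^sub>R u n \<le> w n + d 0"
      unfolding w_def a_def pprt_def by (simp add: diff_le_eq[symmetric])
    then have "norm (real K *\<^sub>R u n) \<le> norm (w n) + norm (d 0)"
      using u by (meson norm_mono_pos norm_triangle_ineq order_trans scaleR_nonneg_nonneg of_nat_0_le_iff)
    moreover have "real K * e \<le> norm (real K *\<^sub>R u n)"
      using er by (simp add: u_def mult_left_mono)
    ultimately show ?thesis using K(1) unfolding eq by linarith
  qed
  ultimately have "1 \<le> (0::real)" by (intro LIMSEQ_le_const) auto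
  then show False by simp
qed

text \<open>A decreasing sequence that is not Cauchy has a subsequence all of whose increments have
  norm at least some \<open>e > 0\<close>, and that subsequence is again decreasing and
  positive.\<close>

lemma decreasing_convergent:
  fixes d :: "nat \<Rightarrow> 'a::banach_lattice"
  assumes null: "disjoint_null TYPE('a)" and d: "\<And>n. 0 \<le> d n" "\<And>n. d (Suc n) \<le> d n"
  shows "convergent d"
proof (rule ccontr)
  have mono: "d n \<le> d m" if "m \<le> n" for m n
    using lift_Suc_antimono_le[of d, OF d(2) that] .
  assume "\<not> convergent d"
  then obtain e where e: "0 < e" "\<forall>N. \<exists>m\<ge>N. \<exists>n\<ge>N. e \<le> norm (d m - d n)"
    unfolding convergent_eq_Cauchy Cauchy_convergent_iff[symmetric] Cauchy_def
    by (auto simp: not_less dist_norm)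
  have step: "\<exists>n\<ge>N. e \<le> norm (d N - d n)" for N
  proof -
    obtain m n where "N \<le> m" "m \<le> n" "e \<le> norm (d m - d n)"
      using e(2) by (metis linear norm_minus_commute)
    moreover then have "norm (d m - d n) \<le> norm (d N - d n)"
      by (intro norm_mono_pos diff_right_mono mono) (simp_all add: mono)
    ultimately show ?thesis by (metis order_trans)
  qed
  have "\<exists>r. \<forall>n::nat. True \<and> r n \<le> r (Suc n) \<and> e \<le> norm (d (r n) - d (r (Suc n)))"
    using step by (intro dependent_nat_choice) auto
  then obtain r where "\<And>n::nat. r n \<le> r (Suc n)" and er: "\<And>n. e \<le> norm (d (r n) - d (r (Suc n)))"
    by blast
  then have "(\<lambda>n. norm (d (r n) - d (r (Suc n)))) \<longlonglongrightarrow> 0"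
    by (intro decreasing_differences_null[OF null] d(1) mono)
  then have "e \<le> 0" using er by (intro LIMSEQ_le_const) auto
  with e show False by simp
qed

text \<open>Null increments make \<open>D\<close> Cauchy as a net. Hence some decreasing sequence
  \<open>d\<close> in \<open>D\<close> has every member of \<open>D\<close> below \<open>d n\<close>
  within \<open>inverse (real (Suc n))\<close> of \<open>d n\<close>. Its limit is a lower bound of
  all of \<open>D\<close>: for \<open>x\<close> in \<open>D\<close>, a member of \<open>D\<close>
  below both \<open>x\<close> and \<open>d n\<close> is close to \<open>d n\<close>.\<close>

lemma disjoint_null_imp_order_continuous:
  assumes null: "disjoint_null TYPE('a::banach_lattice)"
  shows "order_continuous_norm TYPE('a)"
  unfolding order_continuous_norm_def
proof (intro allI impI)
  fix D :: "'a set" and e :: real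
  assume "decreases_to_0 D" and e: "0 < e"
  then have D: "D \<noteq> {}" "\<And>x y. x \<in> D \<Longrightarrow> y \<in> D \<Longrightarrow> \<exists>z\<in>D. z \<le> x \<and> z \<le> y"
      "\<And>x. x \<in> D \<Longrightarrow> 0 \<le> x" "\<And>l. (\<And>x. x \<in> D \<Longrightarrow> l \<le> x) \<Longrightarrow> l \<le> 0"
    unfolding decreases_to_0_def by blast+
  have cauchy: "\<exists>d\<in>D. \<forall>x\<in>D. x \<le> d \<longrightarrow> norm (d - x) < \<delta>" if \<delta>: "0 < \<delta>" for \<delta>
  proof (rule ccontr)
    assume "\<not> ?thesis"
    then have "\<forall>d\<in>D. \<exists>x\<in>D. x \<le> d \<and> \<delta> \<le> norm (d - x)" by (meson not_less)
    then have "\<exists>d. \<forall>n::nat. d n \<in> D \<and> d (Suc n) \<le> d n \<and> \<delta> \<le> norm (d n - d (Suc n))"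
      using D(1) by (intro dependent_nat_choice) auto
    then obtain d where d: "\<And>n::nat. d n \<in> D" "\<And>n. d (Suc n) \<le> d n"
        "\<And>n. \<delta> \<le> norm (d n - d (Suc n))" by blast
    have "(\<lambda>n. norm (d n - d (Suc n))) \<longlonglongrightarrow> 0"
      by (intro decreasing_differences_null[OF null] D(3) d)
    then have "\<delta> \<le> 0" using d by (intro LIMSEQ_le_const) auto
    with \<delta> show False by simp
  qed
  have "\<exists>d. \<forall>n. (d n \<in> D \<and> (\<forall>x\<in>D. x \<le> d n \<longrightarrow> norm (d n - x) < inverse (real (Suc n)))) \<and>
      d (Suc n) \<le> d n"
  proof (rule dependent_nat_choice)
    show "\<exists>d. d \<in> D \<and> (\<forall>x\<in>D. x \<le> d \<longrightarrow> norm (d - x) < inverse (real (Suc 0)))"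
      using cauchy[of 1] by auto
    fix d n assume d: "d \<in> D \<and> (\<forall>x\<in>D. x \<le> d \<longrightarrow> norm (d - x) < inverse (real (Suc n)))"
    obtain c where c: "c \<in> D" "\<forall>x\<in>D. x \<le> c \<longrightarrow> norm (c - x) < inverse (real (Suc (Suc n)))"
      using cauchy[of "inverse (real (Suc (Suc n)))"] by auto
    obtain z where z: "z \<in> D" "z \<le> c" "z \<le> d" using D(2) c d by blast
    \<comment> \<open>The closeness at \<open>c\<close> passes to every smaller member of
      \<open>D\<close>, so it survives the descent below both \<open>c\<close> and
      \<open>d\<close>.\<close>
    have "norm (z - x) < inverse (real (Suc (Suc n)))" if "x \<in> D" "x \<le> z" for x
    proof -
      have "norm (z - x) \<le> norm (c - x)" using that z by (intro norm_mono_pos) auto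
      also have "\<dots> < inverse (real (Suc (Suc n)))" using c that z by (meson order_trans)
      finally show ?thesis .
    qed
    then show "\<exists>z. (z \<in> D \<and> (\<forall>x\<in>D. x \<le> z \<longrightarrow> norm (z - x) < inverse (real (Suc (Suc n))))) \<and> z \<le> d"
      using z by blast
  qed
  then obtain d where d: "\<And>n. d n \<in> D" "\<And>n. d (Suc n) \<le> d n"
      "\<And>n x. x \<in> D \<Longrightarrow> x \<le> d n \<Longrightarrow> norm (d n - x) < inverse (real (Suc n))" by blast
  obtain l where l: "d \<longlonglongrightarrow> l"
    using decreasing_convergent[OF null, of d] D(3) d(1,2) by (auto simp: convergent_def)
  have "l \<le> x" if x: "x \<in> D" for x
  proof -
    obtain z where z: "\<And>n. z n \<in> D" "\<And>n. z n \<le> x" "\<And>n. z n \<le> d n"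
      using D(2)[OF x d(1)] by metis
    have "(\<lambda>n. d n - z n) \<longlonglongrightarrow> 0"
      using d(3)[OF z(1,3)] by (intro Lim_null_comparison[OF _ LIMSEQ_inverse_real_of_nat])
        (auto simp: less_imp_le)
    then have "(\<lambda>n. x + (d n - z n)) \<longlonglongrightarrow> x + 0" by (intro tendsto_intros)
    moreover have "d n \<le> x + (d n - z n)" for n using z(2)[of n] by (simp add: algebra_simps)
    ultimately show ?thesis using limit_mono[OF l] by auto
  qed
  then have "l \<le> 0" by (rule D(4))
  moreover have "0 \<le> l" using nonneg_limit[OF l] D(3) d(1) by blast
  ultimately have "l = 0" by simp
  with l e obtain n where "norm (d n) < e"
    unfolding lim_sequentially by (auto simp: dist_norm)
  then show "\<exists>d\<in>D. \<forall>x\<in>D. x \<le> d \<longrightarrow> norm x < e"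
    using d(1) D(3) norm_mono_pos by (meson le_less_trans)
qed

text \<open>If \<open>U\<close> is the set of upper bounds of an increasing sequence \<open>s\<close>, then \<open>U - s\<close> decreases to
  \<open>0\<close>, even though \<open>s\<close> need not have a supremum.\<close>

lemma order_continuous_imp_disjoint_null:
  assumes oc: "order_continuous_norm TYPE('a::banach_lattice)"
  shows "disjoint_null TYPE('a)"
  unfolding disjoint_null_def
proof (intro allI impI, elim conjE)
  fix x :: 'a and y :: "nat \<Rightarrow> 'a"
  assume dis: "disjoint_seq y" and yx: "\<forall>n. \<bar>y n\<bar> \<le> x"
  define s where "s n = (\<Sum>k<n. \<bar>y k\<bar>)" for n
  have s_mono: "s m \<le> s n" if "m \<le> n" for m n
    unfolding s_def using that by (intro sum_mono2) auto
  have x0: "0 \<le> x" using yx by (meson abs_ge_zero order_trans)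
  \<comment> \<open>For disjoint positive elements the sum is the supremum, so adding
    \<open>\<bar>y n\<bar>\<close> does not leave the bound \<open>x\<close>.\<close>
  have sx: "s n \<le> x" for n
  proof (induction n)
    case (Suc n)
    have "inf \<bar>y n\<bar> (s n) = 0"
      unfolding s_def using dis by (intro inf_sum_eq_0) (auto simp: disjoint_seq_def)
    then have "s (Suc n) = sup \<bar>y n\<bar> (s n)"
      using add_eq_inf_sup[of "\<bar>y n\<bar>" "s n"] by (simp add: s_def add.commute)
    then show ?case using Suc yx by simp
  qed (simp add: s_def x0)
  define U where "U = {u. \<forall>n. s n \<le> u}"
  define D where "D = {u - s n |u n. u \<in> U}"
  have "decreases_to_0 D"
    unfolding decreases_to_0_def
  proof (intro conjI ballI allI impI)
    show "D \<noteq> {}" using sx by (auto simp: D_def U_def)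
    fix a assume "a \<in> D"
    then obtain u m where a: "a = u - s m" "u \<in> U" by (auto simp: D_def)
    then show "0 \<le> a" by (simp add: U_def)
    fix b assume "b \<in> D"
    then obtain v n where b: "b = v - s n" "v \<in> U" by (auto simp: D_def)
    have "inf u v - s (max m n) \<in> D" using a b by (auto simp: D_def U_def)
    moreover have "inf u v - s (max m n) \<le> a" "inf u v - s (max m n) \<le> b"
      unfolding a b by (intro diff_mono s_mono; simp)+
    ultimately show "\<exists>z\<in>D. z \<le> a \<and> z \<le> b" by blast
  next
    fix l assume l: "\<forall>d\<in>D. l \<le> d"
    \<comment> \<open>A lower bound \<open>l\<close> of \<open>D\<close> can be subtracted from an
      upper bound of \<open>s\<close> again and again, so every \<open>real k *\<^sub>R l\<close>
      stays below \<open>x\<close>.\<close>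
    have U: "u - l \<in> U" if "u \<in> U" for u
    proof -
      have "l \<le> u - s n" for n using l that by (auto simp: D_def)
      then show ?thesis by (simp add: U_def algebra_simps)
    qed
    have "x - real k *\<^sub>R l \<in> U" for k
    proof (induction k)
      case (Suc k)
      then show ?case using U[OF Suc] by (simp add: algebra_simps)
    qed (simp add: U_def sx)
    then have "s 0 \<le> x - real k *\<^sub>R l" for k unfolding U_def by blast
    then have "real k *\<^sub>R l \<le> x" for k by (simp add: s_def)
    then show "l \<le> 0" by (rule archimedean_banach_lattice)
  qed
  show "(\<lambda>n. norm (y n)) \<longlonglongrightarrow> 0"
    unfolding lim_sequentially
  proof (intro allI impI)
    fix e :: real assume "0 < e"
    then obtain d where d: "d \<in> D" "\<And>z. z \<in> D \<Longrightarrow> z \<le> d \<Longrightarrow> norm z < e"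
      using oc \<open>decreases_to_0 D\<close> unfolding order_continuous_norm_def by blast
    then obtain u N where u: "d = u - s N" "u \<in> U" by (auto simp: D_def)
    \<comment> \<open>From \<open>N\<close> on, \<open>u - s n\<close> is a member of
      \<open>D\<close> below \<open>d\<close>, and it dominates the increment
      \<open>\<bar>y n\<bar>\<close> of \<open>s\<close>.\<close>
    have "dist (norm (y n)) 0 < e" if "n \<ge> N" for n
    proof -
      have "\<bar>y n\<bar> = s (Suc n) - s n" by (simp add: s_def)
      also have "\<dots> \<le> u - s n" using u by (simp add: U_def)
      finally have "norm \<bar>y n\<bar> \<le> norm (u - s n)" by (intro norm_mono_pos) auto
      also have "\<dots> < e"
        using u s_mono[OF that] by (intro d(2)) (auto simp: D_def)
      finally show ?thesis by simp
    qed
    then show "\<exists>N. \<forall>n\<ge>N. dist (norm (y n)) 0 < e" by blast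
  qed
qed

section \<open>Disjoint sequences of functionals\<close>

lemma linear_dual_apply: "linear (dual_apply f)"
  by (rule bounded_linear.linear[OF bounded_linear_dual_apply])

lemma dual_apply_right_simps:
  "dual_apply f (x + y) = dual_apply f x + dual_apply f y"
  "dual_apply f (x - y) = dual_apply f x - dual_apply f y"
  "dual_apply f (c *\<^sub>R x) = c * dual_apply f x"
  "dual_apply f (sum v A) = (\<Sum>i\<in>A. dual_apply f (v i))"
  by (simp_all add: linear_add linear_diff linear_scale linear_sum linear_dual_apply)

lemma dual_apply_sum_left: "dual_apply (sum h A) x = (\<Sum>i\<in>A. dual_apply (h i) x)"
  by (induction A rule: infinite_finite_induct) simp_all

lemma dual_apply_nonneg: "0 \<le> f \<Longrightarrow> 0 \<le> x \<Longrightarrow> 0 \<le> dual_apply f x"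
  using dual_apply_mono[of 0 f x] by simp

lemma dual_apply_mono_right: "0 \<le> f \<Longrightarrow> x \<le> y \<Longrightarrow> dual_apply f x \<le> dual_apply f y"
  using dual_apply_nonneg[of f "y - x"] by (simp add: dual_apply_right_simps)

lemma dual_apply_le_norm: "norm f \<le> 1 \<Longrightarrow> dual_apply f x \<le> norm x"
  using norm_dual_apply[of f x] mult_right_mono[of "norm f" 1 "norm x"] by simp

text \<open>By the Riesz-Kantorovich formula, \<open>inf g h\<close> at \<open>x\<close> is the
  infimum of the displayed sums over \<open>y\<close> in \<open>{0..x}\<close>. Were all of them at
  least \<open>\<delta>\<close>, the functional \<open>p\<close> of suprema of \<open>g - h\<close>
  would lie at least \<open>\<delta>\<close> below \<open>g\<close> at \<open>x\<close>; but
  \<open>p\<close> dominates \<open>pprt (g - h)\<close>, which is \<open>g\<close> by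
  disjointness.\<close>

lemma dual_disjoint_split:
  fixes g h :: "'a::banach_lattice dual"
  assumes "inf g h = 0" "0 \<le> x" "0 < \<delta>"
  shows "\<exists>y. 0 \<le> y \<and> y \<le> x \<and> dual_apply g (x - y) + dual_apply h y < \<delta>"
proof (rule ccontr)
  assume "\<not> ?thesis"
  then have far: "\<delta> \<le> dual_apply g (x - y) + dual_apply h y" if "0 \<le> y" "y \<le> x" for y
    using that by (meson not_less)
  obtain p where p: "\<And>x y. 0 \<le> y \<Longrightarrow> y \<le> x \<Longrightarrow> dual_apply (g - h) y \<le> dual_apply p x"
      "\<And>x c. 0 \<le> x \<Longrightarrow> (\<And>y. 0 \<le> y \<Longrightarrow> y \<le> x \<Longrightarrow> dual_apply (g - h) y \<le> c) \<Longrightarrow> dual_apply p x \<le> c"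
    using pos_partE[of "g - h"] by blast
  have "dual_apply p x \<le> dual_apply g x - \<delta>"
  proof (rule p(2)[OF assms(2)])
    fix y assume "0 \<le> y" "y \<le> x"
    from far[OF this] show "dual_apply (g - h) y \<le> dual_apply g x - \<delta>"
      by (simp add: dual_apply_right_simps)
  qed
  moreover have "pprt (g - h) \<le> p"
    unfolding pprt_def
  proof (rule sup_least)
    show "g - h \<le> p" using p(1) by (simp add: less_eq_dual_def)
    show "0 \<le> p" using p(1)[OF order_refl] by (simp add: less_eq_dual_def)
  qed
  then have "g \<le> p" using assms(1) by (simp add: pprt_diff_eq)
  then have "dual_apply g x \<le> dual_apply p x" by (rule dual_apply_mono[OF _ assms(2)])
  ultimately show False using assms(3) by simp
qed

text \<open>Disjoint functionals that stay away from \<open>0\<close> at \<open>x\<close> are nearly concentrated on elements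
  \<open>w n\<close> of \<open>{0..x}\<close> that are negligible for the preceding functionals. The elements
  \<open>(w n - c x - (1/c) (w (n+1) + w (n+2) + \<dots>))\<^sup>+\<close> are then disjoint and not null; the infinite sum
  need not exist, but the positive parts over the finite sums decrease and so converge.\<close>

lemma disjoint_functionals_null:
  fixes g :: "nat \<Rightarrow> 'a::banach_lattice dual"
  assumes null: "disjoint_null TYPE('a)"
    and g: "\<And>n. 0 \<le> g n" "\<And>n. norm (g n) \<le> 1" "\<And>m n. m \<noteq> n \<Longrightarrow> inf (g m) (g n) = 0"
    and x: "0 \<le> x"
  shows "(\<lambda>n. dual_apply (g n) x) \<longlonglongrightarrow> 0"
proof (rule ccontr)
  assume "\<not> ?thesis"
  then have "\<not> (\<lambda>n. norm (dual_apply (g n) x)) \<longlonglongrightarrow> 0"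
    using tendsto_norm_zero_cancel[of "\<lambda>n. dual_apply (g n) x"] by blast
  then obtain e r where e: "0 < e" and r: "strict_mono (r :: nat \<Rightarrow> nat)"
      and er: "\<forall>n. e \<le> norm (dual_apply (g (r n)) x)"
    by (rule not_norm_tendsto_zero_subseq) blast
  define h where "h n = g (r n)" for n
  have h: "0 \<le> h n" "norm (h n) \<le> 1" for n by (simp_all add: h_def g)
  have h_dis: "inf (h m) (h n) = 0" if "m \<noteq> n" for m n
    unfolding h_def using that r by (intro g(3)) (simp add: strict_mono_eq)
  have hx: "e \<le> dual_apply (h n) x" for n
    using er dual_apply_nonneg[OF h(1) x] by (simp add: h_def)
  have ex: "e \<le> norm x" using hx[of 0] dual_apply_le_norm[OF h(2)] by (rule order_trans)
  \<comment> \<open>The budget: \<open>h n\<close> is at least \<open>e - e / 4\<close> on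
    \<open>w n\<close>, at most \<open>e / 4\<close> on \<open>c *\<^sub>R x\<close>, and at most
    \<open>(1 / c) * \<delta> = e / 4\<close> on the scaled tail, so \<open>e / 4\<close> remains.
    The bound \<open>c \<le> 1\<close> also serves the disjointness of the
    \<open>V n\<close>.\<close>
  define c where "c = e / (4 * norm x)"
  have x_pos: "0 < norm x" using e ex by linarith
  have c: "0 < c" "c \<le> 1" "c * norm x = e / 4"
    using e ex x_pos by (auto simp: c_def field_simps)
  define \<delta> where "\<delta> = c * e / 4"
  have \<delta>: "0 < \<delta>" "\<delta> \<le> e / 4" "(1 / c) * \<delta> = e / 4"
    using c e mult_right_mono[of c 1 "e / 4"] by (auto simp: \<delta>_def)
  \<comment> \<open>\<open>h n\<close> is disjoint from the sum of its predecessors, so one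
    \<open>w n\<close> is small for all of them. The factors \<open>(1/2) ^ n\<close> keep the sum
    of \<open>h n\<close> over all later \<open>w m\<close> at most \<open>\<delta>\<close>.\<close>
  have "\<exists>w. 0 \<le> w \<and> w \<le> x \<and>
      dual_apply (h n) (x - w) + dual_apply (\<Sum>m<n. h m) w < \<delta> * (1/2) ^ n" for n
    using h h_dis \<delta>(1) by (intro dual_disjoint_split[OF inf_sum_eq_0 x]) auto
  then obtain w where w: "\<And>n. 0 \<le> w n" "\<And>n. w n \<le> x"
      and hw: "\<And>n. dual_apply (h n) (x - w n) + dual_apply (\<Sum>m<n. h m) (w n) < \<delta> * (1/2) ^ n"
    by metis
  have hw_diag: "e - e / 4 \<le> dual_apply (h n) (w n)" for n
  proof -
    have "0 \<le> dual_apply (\<Sum>m<n. h m) (w n)"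
      using h by (intro dual_apply_nonneg sum_nonneg w) auto
    then have "dual_apply (h n) (x - w n) < \<delta> * (1/2) ^ n" using hw[of n] by linarith
    also have "\<dots> \<le> \<delta> * 1" using \<delta> by (intro mult_left_mono power_le_one) auto
    finally show ?thesis using \<delta>(2) hx[of n] by (simp add: dual_apply_right_simps)
  qed
  have hw_off: "dual_apply (h n) (w m) \<le> \<delta> * (1/2) ^ m" if "n < m" for m n
  proof -
    have "dual_apply (h n) (w m) \<le> (\<Sum>k<m. dual_apply (h k) (w m))"
      using that h w by (intro member_le_sum) (auto intro: dual_apply_nonneg)
    moreover have "0 \<le> dual_apply (h m) (x - w m)"
      using h w by (intro dual_apply_nonneg) auto
    ultimately show ?thesis using hw[of m] by (simp add: dual_apply_sum_left)
  qed
  define a where "a n k = w n - c *\<^sub>R x - (1 / c) *\<^sub>R (\<Sum>j<k. w (Suc (n + j)))" for n k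
  define v where "v n k = pprt (a n k)" for n k
  have tail: "0 \<le> (1 / c) *\<^sub>R (\<Sum>j\<in>A. w (Suc (n + j)))" for n A
    using c w by (intro scaleR_nonneg_nonneg sum_nonneg) auto
  have v_Suc: "v n (Suc k) \<le> v n k" for n k
    unfolding v_def a_def using c w
    by (intro pprt_mono diff_left_mono scaleR_left_mono) auto
  have "convergent (v n)" for n
    using v_Suc by (intro decreasing_convergent[OF null]) (simp_all add: v_def)
  then obtain V where V: "\<And>n. v n \<longlonglongrightarrow> V n"
    unfolding convergent_def by metis
  have V_nonneg: "0 \<le> V n" for n
    by (rule nonneg_limit[OF V]) (simp add: v_def)
  have V_le: "V n \<le> v n k" for n k
    using lift_Suc_antimono_le[of "v n", OF v_Suc] by (intro limit_mono[OF V tendsto_const, of k])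
  have V_le1: "V n \<le> pprt (w n - c *\<^sub>R x)" for n
    using V_le[of n 0] by (simp add: v_def a_def)
  \<comment> \<open>Of the subtracted sum only \<open>w m\<close> is kept; it is the last of
    \<open>Suc (m - Suc n)\<close> summands.\<close>
  have V_le2: "V n \<le> pprt (x - (1 / c) *\<^sub>R w m)" if "n < m" for m n
  proof -
    have "w m \<le> (\<Sum>j<Suc (m - Suc n). w (Suc (n + j)))"
      using that w by (simp add: add_increasing sum_nonneg)
    then have "(1 / c) *\<^sub>R w m \<le> (1 / c) *\<^sub>R (\<Sum>j<Suc (m - Suc n). w (Suc (n + j)))"
      using c by (intro scaleR_left_mono) auto
    moreover have "w n - c *\<^sub>R x \<le> x"
      using w[of n] c x by (simp add: diff_le_eq add_increasing2 scaleR_nonneg_nonneg)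
    ultimately have "a n (Suc (m - Suc n)) \<le> x - (1 / c) *\<^sub>R w m"
      unfolding a_def by (intro diff_mono)
    then show ?thesis using V_le[of n "Suc (m - Suc n)"] unfolding v_def
      by (meson pprt_mono order_trans)
  qed
  have "(\<lambda>n. norm (V n)) \<longlonglongrightarrow> 0"
  proof (rule disjoint_nullD[OF null V_nonneg])
    fix m n :: nat
    have "w n - c *\<^sub>R x \<le> w n" using c x by (simp add: scaleR_nonneg_nonneg)
    then have "pprt (w n - c *\<^sub>R x) \<le> pprt (w n)" by (rule pprt_mono)
    with V_le1[of n] w(2)[of n] show "V n \<le> x"
      unfolding pprt_eq_id[OF w(1)] by (meson order_trans)
    assume mn: "m < n"
    \<comment> \<open>Since \<open>c \<le> 1\<close>, the bound for \<open>V n\<close> can be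
      enlarged to \<open>pprt ((1 / c) *\<^sub>R w n - x)\<close>, the positive part of the opposite
      of the element that bounds \<open>V m\<close>.\<close>
    have "w n - c *\<^sub>R x = c *\<^sub>R ((1 / c) *\<^sub>R w n - x)"
      using c by (simp add: scaleR_diff_right)
    also have "\<dots> \<le> c *\<^sub>R pprt ((1 / c) *\<^sub>R w n - x)"
      using c by (intro scaleR_left_mono) (auto simp: pprt_def)
    also have "\<dots> \<le> 1 *\<^sub>R pprt ((1 / c) *\<^sub>R w n - x)"
      using c by (intro scaleR_right_mono) auto
    finally have "pprt (w n - c *\<^sub>R x) \<le> pprt (pprt ((1 / c) *\<^sub>R w n - x))"
      by (intro pprt_mono) simp
    then have "V n \<le> pprt ((1 / c) *\<^sub>R w n - x)"
      using V_le1[of n] by simp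
    then show "inf (V m) (V n) = 0"
      using V_le2[OF mn] V_nonneg by (intro inf_eq_0_mono[OF inf_pprt_eq_0]) auto
  qed
  moreover have "e / 4 \<le> norm (V n)" for n
  proof -
    have "e / 4 \<le> dual_apply (h n) (v n k)" for k
    proof -
      have "(\<Sum>j<k. dual_apply (h n) (w (Suc (n + j)))) \<le> (\<Sum>j<k. \<delta> * (1/2) ^ Suc j)"
      proof (rule sum_mono)
        fix j
        have "dual_apply (h n) (w (Suc (n + j))) \<le> \<delta> * (1/2) ^ Suc (n + j)" by (rule hw_off) simp
        also have "\<dots> \<le> \<delta> * (1/2) ^ Suc j"
          using \<delta> by (intro mult_left_mono power_decreasing) auto
        finally show "dual_apply (h n) (w (Suc (n + j))) \<le> \<delta> * (1/2) ^ Suc j" .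
      qed
      also have "\<dots> = \<delta> * (1 - (1/2) ^ k)"
        by (induction k) (simp_all add: algebra_simps)
      also have "\<dots> \<le> \<delta>" using \<delta> by simp
      finally have "(1 / c) * (\<Sum>j<k. dual_apply (h n) (w (Suc (n + j)))) \<le> (1 / c) * \<delta>"
        using c by (intro mult_left_mono) auto
      moreover have "c * dual_apply (h n) x \<le> c * norm x"
        using c dual_apply_le_norm[OF h(2)] by (intro mult_left_mono) auto
      ultimately have "e / 4 \<le> dual_apply (h n) (a n k)"
        using hw_diag[of n] c(3) \<delta>(3) unfolding a_def dual_apply_right_simps by linarith
      also have "\<dots> \<le> dual_apply (h n) (v n k)"
        unfolding v_def by (intro dual_apply_mono_right h) (simp add: pprt_def)
      finally show ?thesis .
    qed
    moreover have "(\<lambda>k. dual_apply (h n) (v n k)) \<longlonglongrightarrow> dual_apply (h n) (V n)"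
      by (rule bounded_linear.tendsto[OF bounded_linear_dual_apply V])
    ultimately have "e / 4 \<le> dual_apply (h n) (V n)" by (intro LIMSEQ_le_const) auto
    also have "\<dots> \<le> norm (V n)" by (rule dual_apply_le_norm[OF h(2)])
    finally show ?thesis .
  qed
  ultimately have "e / 4 \<le> 0" by (intro LIMSEQ_le_const) auto
  with e show False by simp
qed

section \<open>The Hahn-Banach theorem for sublinear functionals\<close>

text \<open>Homogeneity is an inequality, which is convenient to verify for infima; applying it to
  \<open>inverse c\<close> as well recovers equality.\<close>

definition sublinear :: "('a::real_vector \<Rightarrow> real) \<Rightarrow> bool" where
  "sublinear p \<longleftrightarrow> (\<forall>x y. p (x + y) \<le> p x + p y) \<and> (\<forall>c x. 0 < c \<longrightarrow> p (c *\<^sub>R x) \<le> c * p x)"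

lemma sublinear_add: "sublinear p \<Longrightarrow> p (x + y) \<le> p x + p y"
  by (simp add: sublinear_def)

lemma sublinear_scaleR:
  assumes "sublinear p" "0 < c"
  shows "p (c *\<^sub>R x) = c * p x"
proof (rule antisym)
  show "p (c *\<^sub>R x) \<le> c * p x" using assms by (simp add: sublinear_def)
  have "p (inverse c *\<^sub>R (c *\<^sub>R x)) \<le> inverse c * p (c *\<^sub>R x)"
    using assms unfolding sublinear_def by (meson inverse_positive_iff_positive)
  then show "c * p x \<le> p (c *\<^sub>R x)" using assms by (simp add: field_simps)
qed

lemma sublinear_zero: "sublinear p \<Longrightarrow> p 0 = 0"
  using sublinear_scaleR[of p 2 0] by simp

lemma sublinear_minus: "sublinear p \<Longrightarrow> - p (- x) \<le> p x"
  using sublinear_add[of p x "- x"] by (simp add: sublinear_zero)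

text \<open>\<open>q\<close> is the infimum of \<open>p (x + t *\<^sub>R z) - t * p z\<close> over
  \<open>t \<ge> 0\<close>, finite because \<open>- p (- x)\<close> is a lower bound. The values
  \<open>t = 0\<close> and \<open>t = 1\<close> give the two inequalities; the second makes a
  minimal \<open>p\<close>, which equals its own \<open>q\<close>, superadditive.\<close>

lemma sublinear_shift:
  fixes p :: "'a::real_vector \<Rightarrow> real"
  assumes p: "sublinear p"
  obtains q where "sublinear q" "\<And>x. q x \<le> p x" "\<And>x. q x + p z \<le> p (x + z)"
proof -
  define q where "q x = (INF t\<in>{0..}. p (x + t *\<^sub>R z) - t * p z)" for x
  have tz: "p (t *\<^sub>R z) = t * p z" if "0 \<le> t" for t
    using that sublinear_scaleR[OF p] sublinear_zero[OF p] by (cases "t = 0") auto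
  have low: "- p (- x) \<le> p (x + t *\<^sub>R z) - t * p z" if "0 \<le> t" for x t
    using sublinear_add[OF p, of "x + t *\<^sub>R z" "- x"] tz[OF that] by simp
  have le: "q x \<le> p (x + t *\<^sub>R z) - t * p z" if "0 \<le> t" for x t
    unfolding q_def using that low[of _ x] by (intro cINF_lower) (auto intro!: bdd_belowI)
  have glb: "b \<le> q x" if "\<And>t. 0 \<le> t \<Longrightarrow> b \<le> p (x + t *\<^sub>R z) - t * p z" for b x
    unfolding q_def using that by (intro cINF_greatest) auto
  have "sublinear q"
    unfolding sublinear_def
  proof (intro conjI allI impI)
    fix x y
    have "q (x + y) - (p (y + s *\<^sub>R z) - s * p z) \<le> q x" if s: "0 \<le> s" for s
    proof (rule glb)
      fix t :: real assume t: "0 \<le> t"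
      have "q (x + y) \<le> p (x + y + (t + s) *\<^sub>R z) - (t + s) * p z" using s t by (intro le) simp
      also have "x + y + (t + s) *\<^sub>R z = (x + t *\<^sub>R z) + (y + s *\<^sub>R z)" by (simp add: algebra_simps)
      also have "p \<dots> \<le> p (x + t *\<^sub>R z) + p (y + s *\<^sub>R z)" by (rule sublinear_add[OF p])
      finally show "q (x + y) - (p (y + s *\<^sub>R z) - s * p z) \<le> p (x + t *\<^sub>R z) - t * p z"
        by (simp add: algebra_simps)
    qed
    then have "q (x + y) - q x \<le> q y" by (intro glb) (simp add: algebra_simps)
    then show "q (x + y) \<le> q x + q y" by simp
  next
    fix c :: real and x assume c: "0 < c"
    have "inverse c * q (c *\<^sub>R x) \<le> q x"
    proof (rule glb)
      fix t :: real assume t: "0 \<le> t"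
      have "q (c *\<^sub>R x) \<le> p (c *\<^sub>R x + (c * t) *\<^sub>R z) - c * t * p z" using c t by (intro le) simp
      also have "c *\<^sub>R x + (c * t) *\<^sub>R z = c *\<^sub>R (x + t *\<^sub>R z)" by (simp add: algebra_simps)
      also have "p \<dots> = c * p (x + t *\<^sub>R z)" by (rule sublinear_scaleR[OF p c])
      finally have "q (c *\<^sub>R x) \<le> c * (p (x + t *\<^sub>R z) - t * p z)" by (simp add: algebra_simps)
      then show "inverse c * q (c *\<^sub>R x) \<le> p (x + t *\<^sub>R z) - t * p z"
        using c by (simp add: field_simps)
    qed
    then show "q (c *\<^sub>R x) \<le> c * q x" using c by (simp add: field_simps)
  qed
  moreover have "q x \<le> p x" for x using le[of 0 x] by simp
  moreover have "q x + p z \<le> p (x + z)" for x using le[of 1 x] by simp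
  ultimately show thesis by (rule that)
qed

text \<open>Zorn's lemma for the reversed pointwise order. The pointwise infimum of a chain is
  finite because \<open>- q (- x) \<le> p x\<close>, and subadditive because of any two members one
  lies below the other.\<close>

lemma ex_minimal_sublinear:
  fixes q :: "'a::real_vector \<Rightarrow> real"
  assumes q: "sublinear q"
  obtains m where "sublinear m" "m \<le> q" "\<And>p. sublinear p \<Longrightarrow> p \<le> m \<Longrightarrow> p = m"
proof -
  define A where "A = {p. sublinear p \<and> p \<le> q}"
  have "\<exists>m\<in>A. \<forall>p\<in>A. m \<ge> p \<longrightarrow> p = m"
  proof (rule predicate_Zorn)
    show "partial_order_on A (relation_of (\<ge>) A)"
      by (rule partial_order_on_relation_ofI) auto
    fix C assume "C \<in> Chains (relation_of (\<ge>) A)"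
    then have C: "C \<subseteq> A" "\<And>p r. p \<in> C \<Longrightarrow> r \<in> C \<Longrightarrow> p \<le> r \<or> r \<le> p"
      unfolding Chains_def relation_of_def by auto
    show "\<exists>u\<in>A. \<forall>p\<in>C. p \<ge> u"
    proof (cases "C = {}")
      case True
      then show ?thesis using q by (auto simp: A_def)
    next
      case False
      define u where "u x = (INF p\<in>C. p x)" for x
      have sub: "sublinear p" "p x \<le> q x" if "p \<in> C" for p x
        using that C(1) by (auto simp: A_def le_fun_def)
      have low: "- q (- x) \<le> p x" if "p \<in> C" for p x
        using sublinear_minus[OF sub(1)[OF that], of x] sub(2)[OF that, of "- x"] by linarith
      have le: "u x \<le> p x" if "p \<in> C" for p x
        unfolding u_def using that low by (intro cINF_lower) (auto intro!: bdd_belowI)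
      have glb: "b \<le> u x" if "\<And>p. p \<in> C \<Longrightarrow> b \<le> p x" for b x
        unfolding u_def using that False by (intro cINF_greatest) auto
      have "sublinear u"
        unfolding sublinear_def
      proof (intro conjI allI impI)
        fix x y
        have "u (x + y) \<le> p x + r y" if pr: "p \<in> C" "r \<in> C" for p r
        proof -
          obtain s where s: "s \<in> C" "s \<le> p" "s \<le> r" using C(2)[OF pr] pr by blast
          have "u (x + y) \<le> s (x + y)" by (rule le[OF s(1)])
          also have "\<dots> \<le> s x + s y" by (rule sublinear_add[OF sub(1)[OF s(1)]])
          also have "\<dots> \<le> p x + r y" using s by (intro add_mono) (auto simp: le_fun_def)
          finally show ?thesis .
        qed
        then have "u (x + y) - r y \<le> u x" if "r \<in> C" for r
          using that by (intro glb) (simp add: algebra_simps)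
        then have "u (x + y) - u x \<le> u y" by (intro glb) (simp add: algebra_simps)
        then show "u (x + y) \<le> u x + u y" by simp
      next
        fix c :: real and x assume c: "0 < c"
        have "inverse c * u (c *\<^sub>R x) \<le> u x"
        proof (rule glb)
          fix p assume p: "p \<in> C"
          have "u (c *\<^sub>R x) \<le> c * p x"
            using le[OF p, of "c *\<^sub>R x"] sublinear_scaleR[OF sub(1)[OF p] c] by simp
          then show "inverse c * u (c *\<^sub>R x) \<le> p x" using c by (simp add: field_simps)
        qed
        then show "u (c *\<^sub>R x) \<le> c * u x" using c by (simp add: field_simps)
      qed
      moreover have "u \<le> q"
        unfolding le_fun_def using False le sub(2) by (meson all_not_in_conv order_trans)
      ultimately show ?thesis using le by (auto simp: A_def le_fun_def)
    qed
  qed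
  then show thesis using that unfolding A_def by (auto intro: order_trans)
qed

text \<open>A minimal sublinear functional is not lowered by any shift, hence it is additive.
  Shifting \<open>q\<close> in direction \<open>u\<close> beforehand forces
  \<open>m (- u) \<le> - q u\<close>, which pins the value at \<open>u\<close>.\<close>

theorem hahn_banach_sublinear:
  fixes q :: "'a::real_vector \<Rightarrow> real"
  assumes q: "sublinear q"
  obtains f where "linear f" "\<And>x. f x \<le> q x" "f u = q u"
proof -
  obtain q' where q': "sublinear q'" "\<And>x. q' x \<le> q x" "\<And>x. q' x + q u \<le> q (x + u)"
    using sublinear_shift[OF q] by blast
  obtain m where m: "sublinear m" "m \<le> q'" "\<And>p. sublinear p \<Longrightarrow> p \<le> m \<Longrightarrow> p = m"
    using ex_minimal_sublinear[OF q'(1)] by blast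
  have add: "m (x + z) = m x + m z" for x z
  proof (rule antisym[OF sublinear_add[OF m(1)]])
    obtain p where p: "sublinear p" "\<And>x. p x \<le> m x" "\<And>x. p x + m z \<le> m (x + z)"
      using sublinear_shift[OF m(1)] by blast
    then have "p = m" by (intro m(3)) (auto simp: le_fun_def)
    with p(3) show "m x + m z \<le> m (x + z)" by blast
  qed
  have minus: "m (- x) = - m x" for x
    using add[of x "- x"] sublinear_zero[OF m(1)] by simp
  have "m (c *\<^sub>R x) = c *\<^sub>R m x" for c x
  proof (cases c "0::real" rule: linorder_cases)
    case less
    then have "m ((- c) *\<^sub>R x) = - c * m x" by (intro sublinear_scaleR[OF m(1)]) simp
    then show ?thesis using minus[of "c *\<^sub>R x"] by simp
  qed (simp_all add: sublinear_zero[OF m(1)] sublinear_scaleR[OF m(1)])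
  then have "linear m" by (intro linearI add)
  moreover have "m x \<le> q x" for x
    using m(2) q'(2)[of x] by (auto simp: le_fun_def intro: order_trans)
  moreover have "q u \<le> m u"
  proof -
    have "m (- u) \<le> q' (- u)" using m(2) by (simp add: le_fun_def)
    then show ?thesis using q'(3)[of "- u"] sublinear_zero[OF q] minus[of u] by simp
  qed
  ultimately show thesis using that by (meson antisym)
qed

lemma ex_norming_dual:
  fixes u :: "'a::banach_lattice"
  shows "\<exists>f. norm f \<le> 1 \<and> dual_apply f u = norm u"
proof -
  have "sublinear (norm :: 'a \<Rightarrow> real)"
    by (simp add: sublinear_def norm_triangle_ineq)
  then obtain f where f: "linear f" "\<And>x. f x \<le> norm (x::'a)" "f u = norm u"
    using hahn_banach_sublinear[of norm u] by blast
  have b: "\<bar>f x\<bar> \<le> norm x" for x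
    using f(2)[of x] f(2)[of "- x"] linear_neg[OF f(1)] by (simp add: abs_le_iff)
  then have "bounded_linear f"
    using f(1) by (intro bounded_linear_intro[of _ 1]) (auto simp: linear_add linear_scale)
  then obtain F where F: "dual_apply F = f" using ex_dual by blast
  have "norm F \<le> 1" by (rule norm_dual_bound) (simp_all add: F b)
  with F f(3) show ?thesis by auto
qed

section \<open>Functionals carried by a band\<close>

text \<open>Additivity makes \<open>q (a - b) = p a - p b\<close> independent of the decomposition,
  and domination by \<open>g\<close> gives continuity through
  \<open>\<bar>q x\<bar> \<le> p \<bar>x\<bar>\<close>. This turns a formula that is additive only
  on the cone into a functional.\<close>

lemma ex_dual_extending_cone:
  fixes p :: "'a::banach_lattice \<Rightarrow> real" and g :: "'a dual"
  assumes add: "\<And>a b. 0 \<le> a \<Longrightarrow> 0 \<le> b \<Longrightarrow> p (a + b) = p a + p b"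
    and scale: "\<And>c a. 0 < c \<Longrightarrow> 0 \<le> a \<Longrightarrow> p (c *\<^sub>R a) \<le> c * p a"
    and nonneg: "\<And>a. 0 \<le> a \<Longrightarrow> 0 \<le> p a" and le: "\<And>a. 0 \<le> a \<Longrightarrow> p a \<le> dual_apply g a"
  shows "\<exists>f. \<forall>a\<ge>0. dual_apply f a = p a"
proof -
  have scale_eq: "p (c *\<^sub>R a) = c * p a" if "0 < c" "0 \<le> a" for c a
  proof (rule antisym[OF scale[OF that]])
    have "p (inverse c *\<^sub>R (c *\<^sub>R a)) \<le> inverse c * p (c *\<^sub>R a)"
      using that by (intro scale scaleR_nonneg_nonneg) auto
    then show "c * p a \<le> p (c *\<^sub>R a)" using that by (simp add: field_simps)
  qed
  have p0: "p 0 = 0" using add[of 0 0] by simp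
  define q where "q x = p (pprt x) - p (pprt (- x))" for x
  have split: "x = pprt x - pprt (- x)" for x :: 'a
    using prts[of x] by (simp add: pprt_neg)
  have q_diff: "q (a - b) = p a - p b" if "0 \<le> a" "0 \<le> b" for a b
  proof -
    have "pprt (a - b) + b = a + pprt (- (a - b))"
      using split[of "a - b"] by (simp add: algebra_simps)
    then have "p (pprt (a - b)) + p b = p a + p (pprt (- (a - b)))"
      using that by (metis add zero_le_pprt)
    then show ?thesis by (simp add: q_def)
  qed
  have q_minus: "q (- x) = - q x" for x by (simp add: q_def)
  have q_scale: "q (c *\<^sub>R x) = c * q x" if "0 < c" for c x
  proof -
    have "q (c *\<^sub>R x) = q (c *\<^sub>R pprt x - c *\<^sub>R pprt (- x))"
      by (simp only: scaleR_diff_right[symmetric] split[symmetric])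
    also have "\<dots> = p (c *\<^sub>R pprt x) - p (c *\<^sub>R pprt (- x))"
      using that by (intro q_diff scaleR_nonneg_nonneg) auto
    finally show ?thesis using that by (simp add: scale_eq q_def right_diff_distrib)
  qed
  have "bounded_linear q"
  proof (rule bounded_linear_intro)
    fix x y :: 'a
    have "x + y = (pprt x + pprt y) - (pprt (- x) + pprt (- y))"
      using split[of x] split[of y] by (metis add_diff_add)
    then have "q (x + y) = p (pprt x + pprt y) - p (pprt (- x) + pprt (- y))"
      by (metis q_diff add_nonneg_nonneg zero_le_pprt)
    then show "q (x + y) = q x + q y" by (simp add: add q_def)
  next
    fix c :: real and x :: 'a
    show "q (c *\<^sub>R x) = c *\<^sub>R q x"
    proof (cases c "0::real" rule: linorder_cases)
      case less
      then show ?thesis using q_scale[of "- c" "- x"] by (simp add: q_minus)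
    qed (simp_all add: q_scale, simp add: q_def)
  next
    fix x :: 'a
    have "pprt x + pprt (- x) = \<bar>x\<bar>" by (simp add: abs_prts pprt_neg)
    then have "p (pprt x) + p (pprt (- x)) \<le> dual_apply g \<bar>x\<bar>"
      using add[of "pprt x" "pprt (- x)"] le[of "\<bar>x\<bar>"] by simp
    also have "\<dots> \<le> norm g * norm x"
      using norm_dual_apply[of g "\<bar>x\<bar>"] by simp
    finally show "norm (q x) \<le> norm x * norm g"
      using nonneg[of "pprt x"] nonneg[of "pprt (- x)"] by (simp add: q_def mult.commute abs_le_iff)
  qed
  then obtain f where "dual_apply f = q" using ex_dual by blast
  moreover have "q a = p a" if "0 \<le> a" for a using q_diff[of a 0] that by (simp add: p0)
  ultimately show ?thesis by metis
qed

text \<open>The part \<open>f y = (SUP t. g (inf y (t u)))\<close> of a positive functional \<open>g\<close> that is carried by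
  the band generated by \<open>u\<close>.\<close>

lemma ex_carried_part:
  fixes g :: "'a::banach_lattice dual"
  assumes g: "0 \<le> g" and u: "0 \<le> u"
  obtains f where "0 \<le> f" "f \<le> g" "dual_apply f u = dual_apply g u"
    "\<And>y \<epsilon>. 0 \<le> y \<Longrightarrow> 0 < \<epsilon> \<Longrightarrow> \<exists>t\<ge>0. dual_apply f (y - inf y (t *\<^sub>R u)) < \<epsilon>"
    "\<And>y. 0 \<le> y \<Longrightarrow> (\<And>t. 0 \<le> t \<Longrightarrow> inf y (t *\<^sub>R u) = 0) \<Longrightarrow> dual_apply f y = 0"
proof -
  define p where "p y = (SUP t\<in>{0..}. dual_apply g (inf y (t *\<^sub>R u)))" for y
  have tu: "0 \<le> t *\<^sub>R u" if "0 \<le> t" for t using that u by (simp add: scaleR_nonneg_nonneg)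
  have mono: "dual_apply g a \<le> dual_apply g b" if "a \<le> b" for a b
    using dual_apply_mono_right[OF g that] .
  have ub: "dual_apply g (inf y (t *\<^sub>R u)) \<le> p y" if "0 \<le> t" for y t
    unfolding p_def using that mono[of "inf y _" y] by (intro cSUP_upper) (auto intro!: bdd_aboveI)
  have lub: "p y \<le> b" if "\<And>t. 0 \<le> t \<Longrightarrow> dual_apply g (inf y (t *\<^sub>R u)) \<le> b" for y b
    unfolding p_def using that by (intro cSUP_least) auto
  have p_le: "p y \<le> dual_apply g y" for y by (intro lub mono) simp
  have p_nonneg: "0 \<le> p y" if "0 \<le> y" for y
    using ub[of 0 y] that by (simp add: inf_absorb2)
  have p_add: "p (a + b) = p a + p b" if ab: "0 \<le> a" "0 \<le> b" for a b
  proof (rule antisym)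
    show "p (a + b) \<le> p a + p b"
    proof (rule lub)
      fix t :: real assume t: "0 \<le> t"
      have "inf (a + b) (t *\<^sub>R u) \<le> inf a (t *\<^sub>R u) + inf b (t *\<^sub>R u)"
        using inf_add_le_add_inf[OF tu[OF t] ab] by (simp add: inf_commute)
      from mono[OF this] show "dual_apply g (inf (a + b) (t *\<^sub>R u)) \<le> p a + p b"
        using ub[OF t, of a] ub[OF t, of b] by (simp add: dual_apply_right_simps)
    qed
    have "p a \<le> p (a + b) - dual_apply g (inf b (s *\<^sub>R u))" if s: "0 \<le> s" for s
    proof (rule lub)
      fix t :: real assume t: "0 \<le> t"
      have "inf a (t *\<^sub>R u) + inf b (s *\<^sub>R u) \<le> inf (a + b) ((t + s) *\<^sub>R u)"
        unfolding scaleR_add_left by (intro le_infI add_mono) auto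
      from mono[OF this] show "dual_apply g (inf a (t *\<^sub>R u)) \<le> p (a + b) - dual_apply g (inf b (s *\<^sub>R u))"
        using ub[of "t + s" "a + b"] s t by (simp add: dual_apply_right_simps)
    qed
    then have "p b \<le> p (a + b) - p a" by (intro lub) (simp add: algebra_simps)
    then show "p a + p b \<le> p (a + b)" by simp
  qed
  have p_scale: "p (c *\<^sub>R y) \<le> c * p y" if c: "0 < c" for c y
  proof (rule lub)
    fix t :: real assume t: "0 \<le> t"
    have "inverse c *\<^sub>R inf (c *\<^sub>R y) (t *\<^sub>R u) \<le> inf y ((inverse c * t) *\<^sub>R u)"
    proof (rule le_infI)
      show "inverse c *\<^sub>R inf (c *\<^sub>R y) (t *\<^sub>R u) \<le> y"
        using c scaleR_left_mono[of "inf (c *\<^sub>R y) (t *\<^sub>R u)" "c *\<^sub>R y" "inverse c"] by simp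
      show "inverse c *\<^sub>R inf (c *\<^sub>R y) (t *\<^sub>R u) \<le> (inverse c * t) *\<^sub>R u"
        using c scaleR_left_mono[of "inf (c *\<^sub>R y) (t *\<^sub>R u)" "t *\<^sub>R u" "inverse c"] by simp
    qed
    from mono[OF this] have "inverse c * dual_apply g (inf (c *\<^sub>R y) (t *\<^sub>R u)) \<le> p y"
      using ub[of "inverse c * t" y] c t by (simp add: dual_apply_right_simps)
    then show "dual_apply g (inf (c *\<^sub>R y) (t *\<^sub>R u)) \<le> c * p y"
      using c by (simp add: field_simps)
  qed
  obtain f where f: "\<And>y. 0 \<le> y \<Longrightarrow> dual_apply f y = p y"
    using ex_dual_extending_cone[of p g] p_add p_scale p_nonneg p_le by blast
  show thesis
  proof (rule that)
    show "0 \<le> f" "f \<le> g" by (simp_all add: less_eq_dual_def f p_nonneg p_le)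
    show "dual_apply f u = dual_apply g u"
      using f[OF u] p_le[of u] ub[of 1 u] by simp
    fix y :: 'a assume y: "0 \<le> y"
    show "dual_apply f y = 0" if "\<And>t. 0 \<le> t \<Longrightarrow> inf y (t *\<^sub>R u) = 0"
      using lub[of y 0] p_nonneg[OF y] f[OF y] that by simp
    show "\<exists>t\<ge>0. dual_apply f (y - inf y (t *\<^sub>R u)) < \<epsilon>" if "0 < \<epsilon>" for \<epsilon>
    proof -
      \<comment> \<open>At a level \<open>t\<close> where \<open>p y\<close> is nearly attained, the
        truncation \<open>z\<close> is unchanged by a second truncation, so \<open>p z\<close> is at
        least \<open>dual_apply g z\<close>, which exceeds \<open>p y - \<epsilon>\<close>.\<close>
      obtain t where t: "0 \<le> t" "p y - \<epsilon> < dual_apply g (inf y (t *\<^sub>R u))"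
        using lub[of y "p y - \<epsilon>"] \<open>0 < \<epsilon>\<close> by (meson diff_less_eq less_add_same_cancel1 not_le)
      define z where "z = inf y (t *\<^sub>R u)"
      have "0 \<le> z" using y tu[OF t(1)] by (simp add: z_def)
      moreover have "inf z (t *\<^sub>R u) = z" by (simp add: z_def)
      then have "dual_apply g z \<le> p z" using ub[OF t(1), of z] by simp
      ultimately have "dual_apply f (y - z) < \<epsilon>"
        using t(2) f[OF y] f[of z] by (simp add: dual_apply_right_simps flip: z_def)
      then show ?thesis using t(1) by (auto simp only: z_def)
    qed
  qed
qed

lemma inf_scaleR_eq_0:
  fixes u v :: "'a::banach_lattice"
  assumes "inf u v = 0" "0 \<le> s" "0 \<le> t"
  shows "inf (s *\<^sub>R u) (t *\<^sub>R v) = 0"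
proof -
  \<comment> \<open>A common factor reduces the claim to \<open>inf u v\<close>; the
    \<open>+ 1\<close> keeps it positive when \<open>s = t = 0\<close>.\<close>
  define c where "c = max s t + 1"
  have uv: "0 \<le> u" "0 \<le> v" using assms(1) by (metis inf_le1, metis inf_le2)
  have c: "0 < c" "s \<le> c" "t \<le> c" using assms by (auto simp: c_def)
  have "inverse c *\<^sub>R inf (c *\<^sub>R u) (c *\<^sub>R v) \<le> inf u v"
    using c scaleR_left_mono[OF inf_le1, of "inverse c" "c *\<^sub>R u" "c *\<^sub>R v"]
      scaleR_left_mono[OF inf_le2, of "inverse c" "c *\<^sub>R u" "c *\<^sub>R v"]
    by (intro le_infI) auto
  then have "c *\<^sub>R (inverse c *\<^sub>R inf (c *\<^sub>R u) (c *\<^sub>R v)) \<le> c *\<^sub>R 0"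
    using c unfolding assms(1) by (intro scaleR_left_mono) auto
  then have "inf (c *\<^sub>R u) (c *\<^sub>R v) \<le> 0" using c by simp
  moreover have "0 \<le> inf (c *\<^sub>R u) (c *\<^sub>R v)" using c uv by (simp add: scaleR_nonneg_nonneg)
  ultimately have "inf (c *\<^sub>R u) (c *\<^sub>R v) = 0" by (rule antisym)
  then show ?thesis
    using c assms uv by (elim inf_eq_0_mono) (auto intro: scaleR_nonneg_nonneg scaleR_right_mono)
qed

text \<open>Disjointness is tested at \<open>y \<ge> 0\<close> by splitting off
  \<open>z = inf y (t *\<^sub>R x m)\<close>: \<open>f m\<close> is below \<open>\<epsilon>\<close>
  on \<open>y - z\<close>, and \<open>f n\<close> vanishes on \<open>z\<close>, which is disjoint
  from all nonnegative multiples of \<open>x n\<close>.\<close>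

lemma ex_disjoint_norming_seq:
  fixes x :: "nat \<Rightarrow> 'a::banach_lattice"
  assumes x: "\<And>n. 0 \<le> x n" "disjoint_seq x"
  obtains f :: "nat \<Rightarrow> 'a dual" where "disjoint_seq f" "range f \<subseteq> cball 0 1"
    "\<And>n. norm (x n) \<le> dual_apply (f n) (x n)"
proof -
  have "\<exists>f. 0 \<le> f \<and> norm f \<le> 1 \<and> norm (x n) \<le> dual_apply f (x n) \<and>
      (\<forall>y \<epsilon>. 0 \<le> y \<and> 0 < \<epsilon> \<longrightarrow> (\<exists>t\<ge>0. dual_apply f (y - inf y (t *\<^sub>R x n)) < \<epsilon>)) \<and>
      (\<forall>y. 0 \<le> y \<and> (\<forall>t\<ge>0. inf y (t *\<^sub>R x n) = 0) \<longrightarrow> dual_apply f y = 0)" for n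
  proof -
    obtain g where g: "norm g \<le> 1" "dual_apply g (x n) = norm (x n)"
      using ex_norming_dual by blast
    \<comment> \<open>Passing to \<open>\<bar>g\<bar>\<close> gives positivity at no cost in norm,
      and its value at \<open>x n \<ge> 0\<close> is at least that of \<open>g\<close>.\<close>
    obtain f where f: "0 \<le> f" "f \<le> \<bar>g\<bar>" "dual_apply f (x n) = dual_apply \<bar>g\<bar> (x n)"
      and carr: "\<And>y \<epsilon>. 0 \<le> y \<Longrightarrow> 0 < \<epsilon> \<Longrightarrow> \<exists>t\<ge>0. dual_apply f (y - inf y (t *\<^sub>R x n)) < \<epsilon>"
        "\<And>y. 0 \<le> y \<Longrightarrow> (\<And>t. 0 \<le> t \<Longrightarrow> inf y (t *\<^sub>R x n) = 0) \<Longrightarrow> dual_apply f y = 0"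
      using ex_carried_part[OF abs_ge_zero x(1)] by blast
    have "norm f \<le> 1" using norm_mono_pos[OF f(1,2)] g(1) by simp
    moreover have "norm (x n) \<le> dual_apply f (x n)"
      using dual_apply_mono[OF abs_ge_self[of g] x(1)[of n]] f(3) g(2) by simp
    ultimately show ?thesis using f(1) carr by blast
  qed
  then obtain f where f: "\<And>n. 0 \<le> f n" "\<And>n. norm (f n) \<le> 1"
      "\<And>n. norm (x n) \<le> dual_apply (f n) (x n)"
    and carr: "\<And>n y \<epsilon>. 0 \<le> y \<Longrightarrow> 0 < \<epsilon> \<Longrightarrow> \<exists>t\<ge>0. dual_apply (f n) (y - inf y (t *\<^sub>R x n)) < \<epsilon>"
      "\<And>n y. 0 \<le> y \<Longrightarrow> (\<And>t. 0 \<le> t \<Longrightarrow> inf y (t *\<^sub>R x n) = 0) \<Longrightarrow> dual_apply (f n) y = 0"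
    by metis
  have "inf (f m) (f n) = 0" if mn: "m \<noteq> n" for m n
  proof (rule antisym)
    show "0 \<le> inf (f m) (f n)" using f(1) by simp
    show "inf (f m) (f n) \<le> 0"
      unfolding less_eq_dual_def
    proof (intro allI impI)
      fix y :: 'a assume y: "0 \<le> y"
      have xmn: "inf (x m) (x n) = 0" using x mn by (simp add: disjoint_seq_def)
      have "dual_apply (inf (f m) (f n)) y \<le> 0 + \<epsilon>" if \<epsilon>: "0 < \<epsilon>" for \<epsilon>
      proof -
        obtain t z where t: "0 \<le> t" and z_def: "z = inf y (t *\<^sub>R x m)"
            and fz: "dual_apply (f m) (y - z) < \<epsilon>"
          using carr(1)[OF y \<epsilon>] by blast
        have z: "0 \<le> z" "z \<le> y" "z \<le> t *\<^sub>R x m"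
          using y x(1) t by (simp_all add: z_def scaleR_nonneg_nonneg)
        have "dual_apply (f n) z = 0"
        proof (rule carr(2)[OF z(1)])
          fix s :: real assume s: "0 \<le> s"
          show "inf z (s *\<^sub>R x n) = 0"
            using z x(1) s by (intro inf_eq_0_mono[OF inf_scaleR_eq_0[OF xmn t s]])
              (simp_all add: scaleR_nonneg_nonneg)
        qed
        moreover have "dual_apply (inf (f m) (f n)) z \<le> dual_apply (f n) z"
          by (intro dual_apply_mono z) simp
        moreover have "dual_apply (inf (f m) (f n)) (y - z) \<le> dual_apply (f m) (y - z)"
          using z by (intro dual_apply_mono) simp_all
        ultimately show ?thesis using fz by (simp add: dual_apply_right_simps)
      qed
      then have "dual_apply (inf (f m) (f n)) y \<le> 0" by (rule field_le_epsilon)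
      then show "dual_apply (inf (f m) (f n)) y \<le> dual_apply 0 y" by simp
    qed
  qed
  then have "disjoint_seq f" using f(1) by (simp add: disjoint_seq_def)
  moreover have "range f \<subseteq> cball 0 1" using f(2) by auto
  ultimately show thesis using that f(3) by blast
qed

section \<open>The four statements, with (3) and (4) linked to (1) by a cycle\<close>

theorem corollary2p1:
  shows
    "(order_L_weakly_compact (id_blinfun :: 'a::banach_lattice \<Rightarrow>\<^sub>L 'a) \<longleftrightarrow>
        order_continuous_norm TYPE('a)) \<and>
     (order_L_weakly_compact (id_blinfun :: 'a \<Rightarrow>\<^sub>L 'a) \<longleftrightarrow>
        (\<forall>f::nat \<Rightarrow> 'a dual. disjoint_seq f \<and> range f \<subseteq> cball 0 1 \<longrightarrow>
           limitin weak_star_topology (\<lambda>n. \<bar>f n\<bar>) 0 sequentially)) \<and>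
     (order_L_weakly_compact (id_blinfun :: 'a \<Rightarrow>\<^sub>L 'a) \<longleftrightarrow>
        (\<forall>(x::nat \<Rightarrow> 'a) (f::nat \<Rightarrow> 'a dual).
           order_bounded_seq x \<and> disjoint_seq f \<and> range f \<subseteq> cball 0 1 \<longrightarrow>
           (\<lambda>n. dual_apply (f n) (x n)) \<longlonglongrightarrow> 0))"
  (is "(?one \<longleftrightarrow> ?two) \<and> (?one \<longleftrightarrow> ?three) \<and> (?one \<longleftrightarrow> ?four)")
proof -
  have one: "?one \<longleftrightarrow> disjoint_null TYPE('a)" by (rule order_L_weakly_compact_id_iff)
  have "?one \<longleftrightarrow> ?two"
    unfolding one using disjoint_null_imp_order_continuous order_continuous_imp_disjoint_null by blast
  moreover have "?three" if ?one
  proof (intro allI impI, elim conjE)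
    fix f :: "nat \<Rightarrow> 'a dual" assume f: "disjoint_seq f" "range f \<subseteq> cball 0 1"
    have abs_f: "(\<lambda>n. dual_apply \<bar>f n\<bar> x) \<longlonglongrightarrow> 0" if "0 \<le> x" for x
      using f that \<open>?one\<close> unfolding one
      by (intro disjoint_functionals_null) (auto simp: disjoint_seq_def image_subset_iff)
    have "(\<lambda>n. dual_apply \<bar>f n\<bar> x) \<longlonglongrightarrow> 0" for x
      using dual_apply_le_abs[of "\<bar>f _\<bar>" x]
      by (intro Lim_null_comparison[OF _ abs_f[of "\<bar>x\<bar>"]]) auto
    then show "limitin weak_star_topology (\<lambda>n. \<bar>f n\<bar>) 0 sequentially"
      by (simp add: limitin_weak_star_iff)
  qed
  moreover have "?four" if three: ?three
  proof (intro allI impI, elim conjE)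
    fix x :: "nat \<Rightarrow> 'a" and f :: "nat \<Rightarrow> 'a dual"
    assume "order_bounded_seq x" and f: "disjoint_seq f" "range f \<subseteq> cball 0 1"
    then obtain u v where uv: "\<And>n. u \<le> x n" "\<And>n. x n \<le> v"
      unfolding order_bounded_seq_def by (auto simp: image_subset_iff)
    \<comment> \<open>Both order bounds go into one positive element, so that
      \<open>\<bar>f n\<bar>\<close> is tested at a point independent of \<open>n\<close>.\<close>
    have x_le: "\<bar>x n\<bar> \<le> \<bar>u\<bar> + \<bar>v\<bar>" for n
    proof (rule abs_leI)
      show "x n \<le> \<bar>u\<bar> + \<bar>v\<bar>"
        using uv(2)[of n] abs_ge_self[of v] abs_ge_zero[of u] by (meson add_increasing order_trans)
      have "- x n \<le> - u" using uv(1) by simp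
      then show "- x n \<le> \<bar>u\<bar> + \<bar>v\<bar>"
        using abs_ge_minus_self[of u] abs_ge_zero[of v] by (meson add_increasing2 order_trans)
    qed
    have "norm (dual_apply (f n) (x n)) \<le> dual_apply \<bar>f n\<bar> (\<bar>u\<bar> + \<bar>v\<bar>)" for n
      unfolding real_norm_def using dual_apply_le_abs dual_apply_mono_right[OF abs_ge_zero x_le]
      by (rule order_trans)
    moreover have "(\<lambda>n. dual_apply \<bar>f n\<bar> (\<bar>u\<bar> + \<bar>v\<bar>)) \<longlonglongrightarrow> 0"
      using three f by (simp add: limitin_weak_star_iff)
    ultimately show "(\<lambda>n. dual_apply (f n) (x n)) \<longlonglongrightarrow> 0"
      by (rule Lim_null_comparison[OF always_eventually[OF allI]])
  qed
  moreover have "?one" if four: ?four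
    unfolding one disjoint_null_def
  proof (intro allI impI, elim conjE)
    fix x :: 'a and y :: "nat \<Rightarrow> 'a"
    assume y: "disjoint_seq y" "\<forall>n. \<bar>y n\<bar> \<le> x"
    \<comment> \<open>Statement (4) is applied to the moduli paired with their own disjoint norming
      functionals, so the pairing dominates the norms.\<close>
    have "disjoint_seq (\<lambda>n. \<bar>y n\<bar>)" using y(1) by (simp add: disjoint_seq_def)
    then obtain f :: "nat \<Rightarrow> 'a dual" where f: "disjoint_seq f" "range f \<subseteq> cball 0 1"
        "\<And>n. norm \<bar>y n\<bar> \<le> dual_apply (f n) \<bar>y n\<bar>"
      using ex_disjoint_norming_seq[of "\<lambda>n. \<bar>y n\<bar>"] by auto
    have "order_bounded_seq (\<lambda>n. \<bar>y n\<bar>)"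
      unfolding order_bounded_seq_def using y(2) by (intro exI[of _ 0] exI[of _ x]) auto
    with four f(1,2) have "(\<lambda>n. dual_apply (f n) \<bar>y n\<bar>) \<longlonglongrightarrow> 0" by blast
    with f(3) show "(\<lambda>n. norm (y n)) \<longlonglongrightarrow> 0"
      by (intro Lim_null_comparison[of "\<lambda>n. norm (y n)"]) auto
  qed
  ultimately show ?thesis by blast
qed

end
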